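(* Let $H$ be a Krull monoid with finitely generated class group. Then there exist a finitely generated abelian group $G^*$, a subset $G_0^*\subset G^*$ such that the inclusion $\mathcal B(G_0^* )\hookrightarrow\mathcal F(G_0^* )$ is a divisor theory, and a transfer homomorphism $\theta^*\colon H\to\mathcal B(G_0^* )$ which is a composition of block homomorphisms. In particular, the following hold: (1) $\mathcal L(H)=\mathcal L(G_0^* )$. (2) $\mathsf c(G_0^* )\le\mathsf c(H)\le\max\{\mathsf c(G_0^* ),2\}$. (3) $H$ is locally tame if and only if $\mathcal B(G_0^* )$ is locally tame.
   Context: **Monoids.** A monoid is a semigroup with identity. In this context all monoids are commutative. For a monoid $H$, $H^\times$ is its group of invertible elements; $H$ is reduced if $H^\times=\{1\}$; $H_{\mathrm{red}}=\{aH^\times\mid a\in H\}$; if $H$ is cancellative, $\mathsf q(H)$ is its quotient group. $H$ is unit-cancellative if $a=au$ implies $u\in H^\times$. A non-unit $a$ is an atom if $a=bc$ implies $b\in H^\times$ or $c\in H^\times$; $\mathcal A(H)$ is the set of atoms; $H$ is atomic if every non-unit is a finite product of atoms. For a set $P$, $\mathcal F(P)$ is the (multiplicatively written) free abelian monoid with basis $P$. **Divisor homomorphisms.** Let $\varphi\colon H\to D$ be a homomorphism of commutative cancellative monoids. It is a divisor homomorphism if $\varphi(a)\mid\varphi(b)$ implies $a\mid b$ for all $a,b\in H$; it is cofinal if for every $a\in D$ there is $u\in H$ with $a\mid\varphi(u)$; it is a divisor theory if $D=\mathcal F(P)$ for some set $P$, $\varphi$ is a divisor homomorphism, and for every $p\in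 P$ there is a finite nonempty subset $X\subset H$ with $p=\gcd(\varphi(X))$. The class group of $\varphi$ is $\mathcal C(\varphi)=\mathsf q(D)/\mathsf q(\varphi(H))$, written additively, and $[a]$ denotes the class of $a$. A Krull monoid is a commutative cancellative monoid having a divisor theory; the divisor theory is unique up to unique isomorphism, and the class group $\mathcal C(H)$ of $H$ is the class group of a divisor theory of $H$. **Zero-sum sequences.** For an additive abelian group $G$ and $G_0\subset G$, and for $S=g_1\cdots g_\ell\in\mathcal F(G_0)$, let $\sigma(S)=g_1+\dots+g_\ell\in G$. Then $\mathcal B(G_0)=\{S\in\mathcal F(G_0)\mid\sigma(S)=0\}\subset\mathcal F(G_0)$. **Transfer homomorphisms.** A homomorphism $\theta\colon H\to B$ of atomic unit-cancellative monoids is a transfer homomorphism if: (T1) $B=B^\times\theta(H)B^\times$ and $\theta^{-1}(B^\times)=H^\times$; (T2) if $u\in H$, $b,c\in B$ and $\theta(u)=bc$, then there exist $v,w\in H$ and $\varepsilon\in B^\times$ with $u=vw$, $\theta(v)=b\varepsilon^{-1}$ and $\theta(w)=\varepsilon c$. **Block homomorphisms.** Let $S$ be a Krull monoid, $\varphi\colon S\to\mathcal F(P)$ a cofinal divisor homomorphism with class group $G=\mathcal C(\varphi)$, and $G_P=\{[p]\mid p\in P\}\subset G$. Let $\widetilde{\boldsymbol\beta}\colon\mathcal F(P)\to\mathcal F(G_P)$ be the homomorphism with $\widetilde{\boldsymbol\beta}(p)=[p]$ for all $p\in P$. The map $\boldsymbol\beta=\widetilde{\boldsymbol\beta}\circ\varphi\colon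 S\to\mathcal B(G_P)$ is called the block homomorphism (associated to $\varphi$). **Arithmetic.** If $a=u_1\cdots u_k$ with $u_i$ atoms, $k$ is a factorization length of $a$; $\mathsf L(a)\subset\mathbb N$ is the set of all factorization lengths of $a$, with $\mathsf L(u)=\{0\}$ for $u\in H^\times$; $\mathcal L(H)=\{\mathsf L(a)\mid a\in H\}$. Put $\mathsf Z(H)=\mathcal F(\mathcal A(H_{\mathrm{red}}))$, let $\pi\colon\mathsf Z(H)\to H_{\mathrm{red}}$ be the canonical epimorphism, and $\mathsf Z(a)=\pi^{-1}(aH^\times)$. For $z,z'\in\mathsf Z(H)$ write $z=xy$, $z'=xy'$ with $x=\gcd(z,z')$; the distance is $\mathsf d(z,z')=\max\{|y|,|y'|\}$, where $|\cdot|$ is the length in the free abelian monoid $\mathsf Z(H)$. The catenary degree $\mathsf c(a)$ is the smallest $M\in\mathbb N_0\cup\{\infty\}$ such that any $z,z'\in\mathsf Z(a)$ can be joined by a finite sequence $z=z_0,\dots,z_k=z'$ in $\mathsf Z(a)$ with $\mathsf d(z_{i-1},z_i)\le M$ for all $i$; $\mathsf c(H)=\sup\{\mathsf c(a)\mid a\in H\}$. For $u\in\mathcal A(H_{\mathrm{red}})$, $\mathsf t(H,u)$ is the smallest $M\in\mathbb N_0\cup\{\infty\}$ such that: if $a\in H$ with $\mathsf Z(a)\cap u\mathsf Z(H)\neq\emptyset$ and $z\in\mathsf Z(a)$, then there is $z'\in\mathsf Z(a)\cap u\mathsf Z(H)$ with $\mathsf d(z,z')\le M$. $H$ is locally tame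 if $\mathsf t(H,u)<\infty$ for all $u\in\mathcal A(H_{\mathrm{red}})$. Write $\mathcal L(G_0)=\mathcal L(\mathcal B(G_0))$ and $\mathsf c(G_0)=\mathsf c(\mathcal B(G_0))$. *)

theory Defs
  imports
    "HOL-Algebra.Divisibility"
    "HOL-Algebra.Free_Abelian_Groups"
    "HOL-Library.Extended_Nat"
begin

text \<open>
  Monoids and abelian groups are HOL-Algebra records, written multiplicatively. In particular
  the sum of a sequence over an abelian group is a product in the record.
\<close>

section \<open>Monoids\<close>

definition unit_cancellative :: "('a, 'm) monoid_scheme \<Rightarrow> bool" where
  "unit_cancellative H \<longleftrightarrow>
     (\<forall>a\<in>carrier H. \<forall>u\<in>carrier H. a = a \<otimes>\<^bsub>H\<^esub> u \<longrightarrow> u \<in> Units H)"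

definition atoms :: "('a, 'm) monoid_scheme \<Rightarrow> 'a set" where
  "atoms H = {a \<in> carrier H. a \<notin> Units H \<and>
     (\<forall>b\<in>carrier H. \<forall>c\<in>carrier H. a = b \<otimes>\<^bsub>H\<^esub> c \<longrightarrow> b \<in> Units H \<or> c \<in> Units H)}"

definition atomic :: "('a, 'm) monoid_scheme \<Rightarrow> bool" where
  "atomic H \<longleftrightarrow> (\<forall>a\<in>carrier H - Units H.
     \<exists>us. set us \<subseteq> atoms H \<and> foldr (\<otimes>\<^bsub>H\<^esub>) us \<one>\<^bsub>H\<^esub> = a)"

definition monoid_hom :: "('a, 'm) monoid_scheme \<Rightarrow> ('b, 'n) monoid_scheme \<Rightarrow> ('a \<Rightarrow> 'b) set" where
  "monoid_hom H D = {\<phi> \<in> hom H D. \<phi> \<one>\<^bsub>H\<^esub> = \<one>\<^bsub>D\<^esub>}"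

definition reduced_monoid :: "('a, 'm) monoid_scheme \<Rightarrow> 'a set monoid" where
  "reduced_monoid H =
     \<lparr>carrier = (\<lambda>a. a <#\<^bsub>H\<^esub> Units H) ` carrier H, mult = set_mult H, one = Units H\<rparr>"

definition free_monoid :: "'p set \<Rightarrow> 'p multiset monoid" where
  "free_monoid P = \<lparr>carrier = {M. set_mset M \<subseteq> P}, mult = (+), one = {#}\<rparr>"

definition mset_prod :: "('a, 'm) monoid_scheme \<Rightarrow> 'a multiset \<Rightarrow> 'a" where
  "mset_prod M S = (\<Otimes>\<^bsub>M\<^esub>g\<in>set_mset S. g [^]\<^bsub>M\<^esub> count S g)"

definition fin_gen_group :: "('g, 'm) monoid_scheme \<Rightarrow> bool" where
  "fin_gen_group G \<longleftrightarrow> group G \<and>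
     (\<exists>A. finite A \<and> A \<subseteq> carrier G \<and> generate G A = carrier G)"

section \<open>Divisor theories and class groups\<close>

definition divisor_hom ::
    "('a, 'm) monoid_scheme \<Rightarrow> ('b, 'n) monoid_scheme \<Rightarrow> ('a \<Rightarrow> 'b) \<Rightarrow> bool" where
  "divisor_hom H D \<phi> \<longleftrightarrow>
     comm_monoid_cancel H \<and> comm_monoid_cancel D \<and> \<phi> \<in> monoid_hom H D \<and>
     (\<forall>a\<in>carrier H. \<forall>b\<in>carrier H. \<phi> a divides\<^bsub>D\<^esub> \<phi> b \<longrightarrow> a divides\<^bsub>H\<^esub> b)"

definition cofinal ::
    "('a, 'm) monoid_scheme \<Rightarrow> ('b, 'n) monoid_scheme \<Rightarrow> ('a \<Rightarrow> 'b) \<Rightarrow> bool" where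
  "cofinal H D \<phi> \<longleftrightarrow> (\<forall>a\<in>carrier D. \<exists>u\<in>carrier H. a divides\<^bsub>D\<^esub> \<phi> u)"

definition is_gcd_of_set :: "('a, 'm) monoid_scheme \<Rightarrow> 'a \<Rightarrow> 'a set \<Rightarrow> bool" where
  "is_gcd_of_set D d X \<longleftrightarrow> d \<in> carrier D \<and> (\<forall>x\<in>X. d divides\<^bsub>D\<^esub> x) \<and>
     (\<forall>e\<in>carrier D. (\<forall>x\<in>X. e divides\<^bsub>D\<^esub> x) \<longrightarrow> e divides\<^bsub>D\<^esub> d)"

definition divisor_theory ::
    "('a, 'm) monoid_scheme \<Rightarrow> 'p set \<Rightarrow> ('a \<Rightarrow> 'p multiset) \<Rightarrow> bool" where
  "divisor_theory H P \<phi> \<longleftrightarrow> divisor_hom H (free_monoid P) \<phi> \<and>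
     (\<forall>p\<in>P. \<exists>X. finite X \<and> X \<noteq> {} \<and> X \<subseteq> carrier H \<and>
        is_gcd_of_set (free_monoid P) {#p#} (\<phi> ` X))"

text \<open>
  A definition cannot quantify over the type of the primes. Fixing it to be the type of lists
  over the type of \<open>H\<close> costs no generality: if \<open>\<phi>\<close> is a divisor theory of \<open>H\<close> with prime set
  \<open>P\<close>, choosing for each \<open>p\<close> in \<open>P\<close> a list enumerating a finite set \<open>X\<close> with
  \<open>p = gcd (\<phi> ` X)\<close> is injective, so \<open>P\<close> can be renamed to a set of lists.
\<close>

definition krull_monoid :: "('a, 'm) monoid_scheme \<Rightarrow> bool" where
  "krull_monoid H \<longleftrightarrow> comm_monoid_cancel H \<and>
     (\<exists>(P :: 'a list set) \<phi>. divisor_theory H P \<phi>)"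

text \<open>
  The quotient group of the free abelian monoid on \<open>P\<close> is the free abelian group on \<open>P\<close>;
  \<open>mset_frag\<close> is the canonical embedding.
\<close>

definition mset_frag :: "'p multiset \<Rightarrow> ('p \<Rightarrow>\<^sub>0 int)" where
  "mset_frag M = (\<Sum>p\<in>#M. frag_of p)"

definition quotients_of_image ::
    "('a, 'm) monoid_scheme \<Rightarrow> ('a \<Rightarrow> 'p multiset) \<Rightarrow> ('p \<Rightarrow>\<^sub>0 int) set" where
  "quotients_of_image H \<phi> =
     {mset_frag (\<phi> a) - mset_frag (\<phi> b) | a b. a \<in> carrier H \<and> b \<in> carrier H}"

definition class_group ::
    "('a, 'm) monoid_scheme \<Rightarrow> 'p set \<Rightarrow> ('a \<Rightarrow> 'p multiset) \<Rightarrow> ('p \<Rightarrow>\<^sub>0 int) set monoid" where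
  "class_group H P \<phi> = free_Abelian_group P Mod quotients_of_image H \<phi>"

definition prime_class ::
    "('a, 'm) monoid_scheme \<Rightarrow> 'p set \<Rightarrow> ('a \<Rightarrow> 'p multiset) \<Rightarrow> 'p \<Rightarrow> ('p \<Rightarrow>\<^sub>0 int) set" where
  "prime_class H P \<phi> p = quotients_of_image H \<phi> #>\<^bsub>free_Abelian_group P\<^esub> frag_of p"

section \<open>Zero-sum sequences and block homomorphisms\<close>

definition zero_sum_monoid :: "('g, 'm) monoid_scheme \<Rightarrow> 'g set \<Rightarrow> 'g multiset monoid" where
  "zero_sum_monoid G G0 =
     \<lparr>carrier = {S. set_mset S \<subseteq> G0 \<and> mset_prod G S = \<one>\<^bsub>G\<^esub>}, mult = (+), one = {#}\<rparr>"

text \<open>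
  The class group of \<open>\<phi>\<close> is a group of cosets whose type is built from the type of the primes, so
  that an iteration of the construction would run through infinitely many types. Therefore the
  class group is identified with an abelian group \<open>G\<close> on a given type by means of an isomorphism
  \<open>\<iota>\<close>, and \<open>G0\<close> is the set of (images of) the classes containing primes. Apart from this renaming,
  \<open>\<beta>\<close> is the block homomorphism associated to \<open>\<phi>\<close>; it is only determined on the carrier.
\<close>

definition block_hom ::
    "('a, 'm) monoid_scheme \<Rightarrow> 'u monoid \<Rightarrow> 'u set \<Rightarrow> ('a \<Rightarrow> 'u multiset) \<Rightarrow> bool" where
  "block_hom S G G0 \<beta> \<longleftrightarrow> krull_monoid S \<and> comm_group G \<and>
     (\<exists>(P :: 'u set) \<phi> \<iota>.
        divisor_hom S (free_monoid P) \<phi> \<and> cofinal S (free_monoid P) \<phi> \<and>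
        \<iota> \<in> iso (class_group S P \<phi>) G \<and>
        G0 = (\<lambda>p. \<iota> (prime_class S P \<phi> p)) ` P \<and>
        (\<forall>a\<in>carrier S. \<beta> a = image_mset (\<lambda>p. \<iota> (prime_class S P \<phi> p)) (\<phi> a)))"

text \<open>
  \<open>block_hom_composition H G G0 \<theta>\<close>: the map \<open>\<theta>\<close> from \<open>H\<close> to the zero-sum sequences over \<open>G0\<close> is
  a composition of one or more block homomorphisms. The type \<open>'u\<close> of all primes and classes that
  occur may be any infinite type into which the type of \<open>H\<close> embeds, such as \<open>'a list\<close>, without
  loss of generality: by cofinality every prime divides some \<open>\<phi> u\<close>, and each \<open>\<phi> u\<close> has only
  finitely many prime divisors, so the number of primes is at most \<open>max (|S|, \<aleph>\<^sub>0)\<close>; the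
  same bound then holds for the class group and for the monoid of zero-sum sequences over it.
\<close>

inductive block_hom_composition ::
    "('a, 'm) monoid_scheme \<Rightarrow> 'u monoid \<Rightarrow> 'u set \<Rightarrow> ('a \<Rightarrow> 'u multiset) \<Rightarrow> bool"
  for H :: "('a, 'm) monoid_scheme" where
  single: "block_hom H G G0 \<beta> \<Longrightarrow> block_hom_composition H G G0 \<beta>"
| comp: "block_hom_composition H G G0 \<theta> \<Longrightarrow> block_hom (zero_sum_monoid G G0) G' G0' \<beta> \<Longrightarrow>
    block_hom_composition H G' G0' (\<beta> \<circ> \<theta>)"

section \<open>Transfer homomorphisms\<close>

definition transfer_hom ::
    "('a, 'm) monoid_scheme \<Rightarrow> ('b, 'n) monoid_scheme \<Rightarrow> ('a \<Rightarrow> 'b) \<Rightarrow> bool" where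
  "transfer_hom H B \<theta> \<longleftrightarrow>
     comm_monoid H \<and> atomic H \<and> unit_cancellative H \<and>
     comm_monoid B \<and> atomic B \<and> unit_cancellative B \<and>
     \<theta> \<in> monoid_hom H B \<and>
     carrier B = {\<epsilon> \<otimes>\<^bsub>B\<^esub> \<theta> a \<otimes>\<^bsub>B\<^esub> \<eta> | \<epsilon> a \<eta>. \<epsilon> \<in> Units B \<and> a \<in> carrier H \<and> \<eta> \<in> Units B} \<and>
     {a \<in> carrier H. \<theta> a \<in> Units B} = Units H \<and>
     (\<forall>u\<in>carrier H. \<forall>b\<in>carrier B. \<forall>c\<in>carrier B. \<theta> u = b \<otimes>\<^bsub>B\<^esub> c \<longrightarrow>
        (\<exists>v\<in>carrier H. \<exists>w\<in>carrier H. \<exists>\<epsilon>\<in>Units B.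
           u = v \<otimes>\<^bsub>H\<^esub> w \<and> \<theta> v = b \<otimes>\<^bsub>B\<^esub> inv\<^bsub>B\<^esub> \<epsilon> \<and> \<theta> w = \<epsilon> \<otimes>\<^bsub>B\<^esub> c))"

section \<open>Arithmetic\<close>

definition length_set :: "('a, 'm) monoid_scheme \<Rightarrow> 'a \<Rightarrow> nat set" where
  "length_set H a = (if a \<in> Units H then {0}
     else {length us | us. set us \<subseteq> atoms H \<and> foldr (\<otimes>\<^bsub>H\<^esub>) us \<one>\<^bsub>H\<^esub> = a})"

definition length_system :: "('a, 'm) monoid_scheme \<Rightarrow> nat set set" where
  "length_system H = length_set H ` carrier H"

definition factorization_monoid :: "('a, 'm) monoid_scheme \<Rightarrow> 'a set multiset monoid" where
  "factorization_monoid H = free_monoid (atoms (reduced_monoid H))"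

definition factorizations :: "('a, 'm) monoid_scheme \<Rightarrow> 'a \<Rightarrow> 'a set multiset set" where
  "factorizations H a = {z \<in> carrier (factorization_monoid H).
     mset_prod (reduced_monoid H) z = a <#\<^bsub>H\<^esub> Units H}"

text \<open>The greatest common divisor in a free abelian monoid is the intersection of multisets.\<close>

definition fdist :: "'b multiset \<Rightarrow> 'b multiset \<Rightarrow> nat" where
  "fdist z z' = (let x = z \<inter># z' in max (size (z - x)) (size (z' - x)))"

definition catenary_degree_elt :: "('a, 'm) monoid_scheme \<Rightarrow> 'a \<Rightarrow> enat" where
  "catenary_degree_elt H a = (LEAST M.
     \<forall>z\<in>factorizations H a. \<forall>z'\<in>factorizations H a.
       \<exists>(k::nat) f. f 0 = z \<and> f k = z' \<and> (\<forall>i\<le>k. f i \<in> factorizations H a) \<and>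
         (\<forall>i<k. enat (fdist (f i) (f (Suc i))) \<le> M))"

definition catenary_degree :: "('a, 'm) monoid_scheme \<Rightarrow> enat" where
  "catenary_degree H = (SUP a\<in>carrier H. catenary_degree_elt H a)"

definition factorizations_through ::
    "('a, 'm) monoid_scheme \<Rightarrow> 'a set \<Rightarrow> 'a \<Rightarrow> 'a set multiset set" where
  "factorizations_through H u a =
     factorizations H a \<inter> (\<lambda>y. {#u#} + y) ` carrier (factorization_monoid H)"

definition tame_degree :: "('a, 'm) monoid_scheme \<Rightarrow> 'a set \<Rightarrow> enat" where
  "tame_degree H u = (LEAST M.
     \<forall>a\<in>carrier H. factorizations_through H u a \<noteq> {} \<longrightarrow>
       (\<forall>z\<in>factorizations H a. \<exists>z'\<in>factorizations_through H u a. enat (fdist z z') \<le> M))"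

definition locally_tame :: "('a, 'm) monoid_scheme \<Rightarrow> bool" where
  "locally_tame H \<longleftrightarrow> (\<forall>u\<in>atoms (reduced_monoid H). tame_degree H u < \<infinity>)"

end

theory Submission
  imports Defs
begin

text \<open>
  A divisor homomorphism \<open>\<phi>\<close> from \<open>H\<close> into the free monoid on \<open>P\<close> identifies the reduced monoid
  of \<open>H\<close> with a submonoid of multisets over \<open>P\<close> that is closed under differences, and lengths,
  catenary degree and local tameness of \<open>H\<close> can be read off this image
  (locale \<open>free_divisor_hom\<close>). Let \<open>c\<close> map each prime to its class. A multiset lies in the image
  iff the sequence of its classes has sum zero. So the image is the preimage of the monoid of
  zero-sum sequences under the map that merges the primes of each class (locale \<open>merged_primes\<close>).
  Since decompositions lift along this map, block homomorphisms are transfer homomorphisms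
  and preserve sets of lengths. Factorizations with the same image are connected by moves
  which exchange two primes of one class between two atoms; they have distance two, whence the bound
  on the catenary degree. For tameness only as many factors matter as the given atom has primes.
  All these comparisons pass from one block homomorphism to compositions
  (\<open>block_hom_composition_transfer\<close>).

  It remains to reach a set \<open>G0\<close> for which the inclusion of the zero-sum sequences over \<open>G0\<close> into the
  sequences over \<open>G0\<close> is a divisor theory. This can fail in two ways: some primes may be redundant for
  testing divisibility, and the valuations at some prime may have a common divisor. Discarding a maximal
  set of redundant primes and dividing the other valuations by their common divisor gives the
  divisor theory \<open>\<psi>\<close> of the monoid (locale \<open>minimal_primes\<close>). Its block homomorphism leads to
  another monoid of zero-sum sequences, over another group. But the classes of \<open>\<psi>\<close> may contain several
  primes, and merging these can spoil the property again, so the construction has to be iterated.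

  The iteration ends because of a spanning element: an element \<open>w\<close> such that the inverse of
  each prime class is a sum of classes of primes dividing \<open>w\<close>. Such an element exists iff the
  class group is finitely generated, provided that \<open>\<phi>\<close> is cofinal. Primes that do not divide \<open>w\<close> are
  never redundant and have valuation one somewhere, so only the finitely many prime divisors of \<open>w\<close>
  need a correction. The construction sends \<open>w\<close> to a spanning element
  again, of smaller size unless nothing had to be corrected (\<open>shrink_or_divisor_theory\<close>). Induction
  on the size of \<open>w\<close> finishes the proof.
\<close>

section \<open>Factorizations in saturated monoids of multisets\<close>

text \<open>
  The abstract form of the image of a divisor homomorphism: closure under differences says that
  divisibility in the submonoid is divisibility in the free monoid.
\<close>

locale saturated_submonoid =
  fixes A :: "'p multiset set"
  assumes zero_mem: "{#} \<in> A"
    and add_mem: "\<lbrakk>a \<in> A; b \<in> A\<rbrakk> \<Longrightarrow> a + b \<in> A"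
    and diff_mem: "\<lbrakk>a \<in> A; b \<in> A; a \<subseteq># b\<rbrakk> \<Longrightarrow> b - a \<in> A"

definition ms_atoms :: "'p multiset set \<Rightarrow> 'p multiset set" where
  "ms_atoms A = {u \<in> A. u \<noteq> {#} \<and> (\<forall>b\<in>A. \<forall>c\<in>A. u = b + c \<longrightarrow> b = {#} \<or> c = {#})}"

definition ms_factorizations :: "'p multiset set \<Rightarrow> 'p multiset \<Rightarrow> 'p multiset multiset set" where
  "ms_factorizations A a = {z. set_mset z \<subseteq> ms_atoms A \<and> \<Sum>\<^sub># z = a}"

text \<open>
  Chains of factorizations are treated as a reflexive transitive closure, so that they can be mapped,
  lifted and concatenated by induction; \<open>chained Z M\<close> bounds the catenary degree.
\<close>

definition links :: "'b multiset set \<Rightarrow> enat \<Rightarrow> ('b multiset \<times> 'b multiset) set" where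
  "links Z M = {(z, z'). z \<in> Z \<and> z' \<in> Z \<and> enat (fdist z z') \<le> M}"

definition chained :: "'b multiset set \<Rightarrow> enat \<Rightarrow> bool" where
  "chained Z M \<longleftrightarrow> (\<forall>z\<in>Z. \<forall>z'\<in>Z. (z, z') \<in> (links Z M)\<^sup>*)"

definition tame_bound :: "'p multiset set \<Rightarrow> 'p multiset \<Rightarrow> enat \<Rightarrow> bool" where
  "tame_bound A u M \<longleftrightarrow> (\<forall>a\<in>A. (\<exists>z\<in>ms_factorizations A a. u \<in># z) \<longrightarrow>
     (\<forall>z\<in>ms_factorizations A a. \<exists>z'\<in>ms_factorizations A a. u \<in># z' \<and> enat (fdist z z') \<le> M))"

lemma fdist_alt: "fdist z z' = max (size (z - z')) (size (z' - z))"
  unfolding fdist_def Let_def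
  by (metis diff_intersect_left_idem inter_mset_def multiset_inter_commute)

lemma fdist_add_left [simp]: "fdist (w + z) (w + z') = fdist z z'"
  by (simp add: fdist_alt)

lemma fdist_le_max_size: "fdist z z' \<le> max (size z) (size z')"
  unfolding fdist_alt by (meson diff_subset_eq_self max.mono size_mset_mono)

text \<open>
  Splitting off the greatest common divisor makes the distance visible as the sizes of the two remainders.
\<close>

lemma fdist_decomp: "\<exists>x y y'. z = x + y \<and> z' = x + y' \<and> y \<inter># y' = {#} \<and> fdist z z' = max (size y) (size y')"
proof (intro exI conjI)
  show "z = z \<inter># z' + (z - z')" "z' = z \<inter># z' + (z' - z)"
    by (auto simp: multiset_eq_iff)
  show "(z - z') \<inter># (z' - z) = {#}" by (auto simp: multiset_eq_iff)
qed (rule fdist_alt)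

lemma fdist_disjoint: "y \<inter># y' = {#} \<Longrightarrow> fdist y y' = max (size y) (size y')"
  unfolding fdist_def Let_def by simp

lemma fdist_image_le: "fdist (image_mset f z) (image_mset f z') \<le> fdist z z'"
proof -
  obtain x y y' where *: "z = x + y" "z' = x + y'" "fdist z z' = max (size y) (size y')"
    using fdist_decomp by metis
  then show ?thesis
    using fdist_le_max_size[of "image_mset f y" "image_mset f y'"] by simp
qed

lemma fdist_image_inj:
  assumes "inj_on f (set_mset z \<union> set_mset z')"
  shows "fdist (image_mset f z) (image_mset f z') = fdist z z'"
proof -
  obtain x y y' where *: "z = x + y" "z' = x + y'" "y \<inter># y' = {#}"
      "fdist z z' = max (size y) (size y')"
    using fdist_decomp by metis
  have "set_mset y \<inter> set_mset y' = {}"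
    using *(3) by (metis set_mset_empty set_mset_inter)
  then have "set_mset (image_mset f y) \<inter> set_mset (image_mset f y') = {}"
    using assms * by (auto simp: inj_on_def)
  then have "image_mset f y \<inter># image_mset f y' = {#}"
    by (metis set_mset_eq_empty_iff set_mset_inter)
  then show ?thesis using * by (simp add: fdist_disjoint)
qed

lemma chained_mono: "chained Z M \<Longrightarrow> M \<le> N \<Longrightarrow> chained Z N"
  unfolding chained_def
proof (intro ballI)
  fix z z' assume "M \<le> N" "\<forall>z\<in>Z. \<forall>z'\<in>Z. (z, z') \<in> (links Z M)\<^sup>*" "z \<in> Z" "z' \<in> Z"
  moreover from \<open>M \<le> N\<close> have "links Z M \<subseteq> links Z N" by (auto simp: links_def)
  ultimately show "(z, z') \<in> (links Z N)\<^sup>*" using rtrancl_mono by blast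
qed

lemma chained_infinity: "chained Z \<infinity>"
  by (auto simp: chained_def links_def)

lemma chained_image:
  assumes "chained Z M" and "g ` Z = Z'"
    and "\<And>z z'. \<lbrakk>z \<in> Z; z' \<in> Z\<rbrakk> \<Longrightarrow> fdist (g z) (g z') \<le> fdist z z'"
  shows "chained Z' M"
proof -
  have "(g z, g z') \<in> (links Z' M)\<^sup>*" if "(z, z') \<in> (links Z M)\<^sup>*" for z z'
    using that
  proof induction
    case (step y y')
    have "(g y, g y') \<in> links Z' M"
      using step(2) assms(2,3) unfolding links_def
      by (auto intro: order_trans[of _ "enat (fdist y y')"])
    then show ?case using step(3) by (rule rtrancl_into_rtrancl[rotated])
  qed simp
  then show ?thesis using assms(1,2) unfolding chained_def by blast
qed

lemma tame_bound_mono: "tame_bound A u M \<Longrightarrow> M \<le> N \<Longrightarrow> tame_bound A u N"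
  unfolding tame_bound_def by (meson order_trans)

lemma ms_atomsD: "u \<in> ms_atoms A \<Longrightarrow> u \<in> A" "u \<in> ms_atoms A \<Longrightarrow> u \<noteq> {#}"
  by (auto simp: ms_atoms_def)

lemma ms_factorizations_add:
  "z \<in> ms_factorizations A a \<Longrightarrow> z' \<in> ms_factorizations A b \<Longrightarrow> z + z' \<in> ms_factorizations A (a + b)"
  by (auto simp: ms_factorizations_def)

lemma ms_factorizations_empty: "ms_factorizations A {#} = {{#}}"
proof -
  have "z = {#}" if "z \<in> ms_factorizations A {#}" for z
  proof (rule ccontr)
    assume "z \<noteq> {#}"
    then obtain u z1 where "z = add_mset u z1" by (metis multiset_nonemptyE insert_DiffM)
    with that show False by (auto simp: ms_factorizations_def ms_atoms_def)
  qed
  then show ?thesis by (auto simp: ms_factorizations_def)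
qed

context saturated_submonoid begin

lemma Union_mem: "set_mset z \<subseteq> A \<Longrightarrow> \<Sum>\<^sub># z \<in> A"
  by (induction z) (auto intro: zero_mem add_mem)

lemma repeat_mem: "a \<in> A \<Longrightarrow> repeat_mset n a \<in> A"
  by (induction n) (auto intro: zero_mem add_mem)

lemma right_summand_mem: "a \<in> A \<Longrightarrow> a + b \<in> A \<Longrightarrow> b \<in> A"
  using diff_mem[of a "a + b"] by simp

lemma ms_factorizations_mem: "z \<in> ms_factorizations A a \<Longrightarrow> a \<in> A"
  using Union_mem[of z] by (auto simp: ms_factorizations_def ms_atoms_def)

text \<open>Both parts of a proper decomposition have smaller size, so decomposing comes to an end.\<close>

lemma ms_factorizations_nonempty: "a \<in> A \<Longrightarrow> ms_factorizations A a \<noteq> {}"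
proof (induction "size a" arbitrary: a rule: less_induct)
  case less
  consider "a = {#}" | "a \<in> ms_atoms A" | b c where "b \<in> A" "c \<in> A" "a = b + c" "b \<noteq> {#}" "c \<noteq> {#}"
    using less.prems by (auto simp: ms_atoms_def)
  then show ?case
  proof cases
    case 1
    then show ?thesis by (simp add: ms_factorizations_empty)
  next
    case 2
    then have "{#a#} \<in> ms_factorizations A a" by (simp add: ms_factorizations_def)
    then show ?thesis by blast
  next
    case 3
    then have "size b < size a" "size c < size a" by (auto simp: nonempty_has_size)
    with less.hyps 3 obtain z z' where "z \<in> ms_factorizations A b" "z' \<in> ms_factorizations A c"
      by blast
    with 3 show ?thesis using ms_factorizations_add by blast
  qed
qed

end

section \<open>Merging primes\<close>

text \<open>
  A map \<open>c\<close> that merges primes induces a homomorphism of free abelian monoids.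
  The preimage of a saturated submonoid \<open>B\<close> of the target is compared with \<open>B\<close>. Every decomposition
  of the image of a multiset lifts to the multiset; this is what makes the factorization theory of
  the preimage and of \<open>B\<close> agree, up to exchanging primes with the same image, a move of distance two.
\<close>

locale merged_primes = B: saturated_submonoid B
  for B :: "'g multiset set" +
  fixes c :: "'p \<Rightarrow> 'g" and P :: "'p set"
  assumes B_subset: "S \<in> B \<Longrightarrow> set_mset S \<subseteq> c ` P"
begin

definition preimage :: "'p multiset set" where
  "preimage = {M. set_mset M \<subseteq> P \<and> image_mset c M \<in> B}"

lemma preimage_iff: "M \<in> preimage \<longleftrightarrow> set_mset M \<subseteq> P \<and> image_mset c M \<in> B"
  by (simp add: preimage_def)

sublocale preimage: saturated_submonoid preimage
proof
  show "b - a \<in> preimage" if "a \<in> preimage" "b \<in> preimage" "a \<subseteq># b" for a b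
    using that B.diff_mem[of "image_mset c a" "image_mset c b"]
    by (auto simp: preimage_iff image_mset_Diff image_mset_subseteq_mono dest: in_diffD)
qed (auto simp: preimage_iff intro: B.zero_mem B.add_mem)

lemma lift_exists: "S \<in> B \<Longrightarrow> \<exists>M\<in>preimage. image_mset c M = S"
proof -
  assume S: "S \<in> B"
  let ?i = "inv_into P c"
  have "image_mset (c \<circ> ?i) S = image_mset id S"
    using B_subset[OF S] by (intro image_mset_cong) (auto simp: f_inv_into_f subset_iff)
  then have "image_mset c (image_mset ?i S) = S"
    by (simp add: image_mset.compositionality)
  moreover have "set_mset (image_mset ?i S) \<subseteq> P"
    using B_subset[OF S] by (auto intro: inv_into_into)
  ultimately show ?thesis using S preimage_iff by metis
qed

lemma lift_split:
  assumes "a \<in> preimage" "image_mset c a = S + T" "S \<in> B"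
  obtains b d where "b \<in> preimage" "d \<in> preimage" "a = b + d" "image_mset c b = S" "image_mset c d = T"
proof -
  obtain b d where bd: "a = b + d" "image_mset c b = S" "image_mset c d = T"
    using image_mset_eq_plusD[OF assms(2)] by auto
  have "T \<in> B"
    using assms bd B.right_summand_mem[OF assms(3)] by (auto simp: preimage_iff)
  then show ?thesis using bd assms by (intro that[of b d]) (auto simp: preimage_iff)
qed

lemma atoms_iff: "u \<in> ms_atoms preimage \<longleftrightarrow> set_mset u \<subseteq> P \<and> image_mset c u \<in> ms_atoms B"
proof
  assume u: "u \<in> ms_atoms preimage"
  have "b = {#} \<or> d = {#}" if bd: "b \<in> B" "d \<in> B" "image_mset c u = b + d" for b d
  proof -
    obtain b' d' where "b' \<in> preimage" "d' \<in> preimage" "u = b' + d'" "image_mset c b' = b" "image_mset c d' = d"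
      using lift_split[OF ms_atomsD(1)[OF u] bd(3,1)] by metis
    then show ?thesis using u by (auto simp: ms_atoms_def)
  qed
  then show "set_mset u \<subseteq> P \<and> image_mset c u \<in> ms_atoms B"
    using u by (auto simp: ms_atoms_def preimage_def)
next
  assume "set_mset u \<subseteq> P \<and> image_mset c u \<in> ms_atoms B"
  then show "u \<in> ms_atoms preimage"
    by (auto simp: ms_atoms_def preimage_def)
qed

lemma image_Union: "image_mset c (\<Sum>\<^sub># z) = \<Sum>\<^sub># (image_mset (image_mset c) z)"
  by (induction z) auto

lemma image_factorization:
  "z \<in> ms_factorizations preimage a \<Longrightarrow> image_mset (image_mset c) z \<in> ms_factorizations B (image_mset c a)"
  by (auto simp: ms_factorizations_def image_Union atoms_iff)

text \<open>
  The factors are split off one by one; the rest of \<open>a\<close> stays in the preimage because \<open>B\<close> is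
  closed under differences.
\<close>

lemma lift_factorization:
  assumes "a \<in> preimage" "Z \<in> ms_factorizations B (image_mset c a)"
  shows "\<exists>z\<in>ms_factorizations preimage a. image_mset (image_mset c) z = Z"
  using assms
proof (induction Z arbitrary: a)
  case empty
  then show ?case by (auto simp: ms_factorizations_def)
next
  case (add U Z)
  have U: "U \<in> ms_atoms B" and "image_mset c a = U + \<Sum>\<^sub># Z" and Z: "Z \<in> ms_factorizations B (\<Sum>\<^sub># Z)"
    using add.prems by (auto simp: ms_factorizations_def)
  with add.prems obtain u b where ub: "u \<in> preimage" "b \<in> preimage" "a = u + b" "image_mset c u = U" "image_mset c b = \<Sum>\<^sub># Z"
    by (metis lift_split ms_atomsD(1))
  then obtain z where z: "z \<in> ms_factorizations preimage b" "image_mset (image_mset c) z = Z"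
    using add.IH Z by metis
  have "u \<in> ms_atoms preimage" using U ub by (auto simp: atoms_iff preimage_iff)
  then have "add_mset u z \<in> ms_factorizations preimage a"
    using z ub by (auto simp: ms_factorizations_def)
  with z ub show ?case by (intro bexI[of _ "add_mset u z"]) auto
qed

lemma image_factorizations:
  "a \<in> preimage \<Longrightarrow> image_mset (image_mset c) ` ms_factorizations preimage a = ms_factorizations B (image_mset c a)"
  using image_factorization lift_factorization by blast

lemma lengths_eq:
  "a \<in> preimage \<Longrightarrow> size ` ms_factorizations preimage a = size ` ms_factorizations B (image_mset c a)"
  by (simp flip: image_factorizations add: image_image)

lemma chained_image_merged:
  "a \<in> preimage \<Longrightarrow> chained (ms_factorizations preimage a) M \<Longrightarrow> chained (ms_factorizations B (image_mset c a)) M"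
  by (rule chained_image[OF _ image_factorizations]) (auto intro: fdist_image_le)

text \<open>
  Two atoms with the same image contain equally many primes of each class. So if a prime \<open>p\<close> occurs
  more often in \<open>u'\<close> than in \<open>u\<close>, then a prime \<open>q\<close> of the same class occurs more often in \<open>u\<close> than
  in \<open>u'\<close>, and if \<open>u'\<close> divides the product, then some factor other than \<open>u\<close> contains \<open>p\<close>. Exchanging
  \<open>p\<close> and \<open>q\<close> between that factor and \<open>u\<close> changes two atoms and brings \<open>u\<close> closer to \<open>u'\<close>.
\<close>

lemma exchange_to_atom:
  assumes "add_mset u w \<in> ms_factorizations preimage a" "u' \<in> ms_atoms preimage"
    and "image_mset c u = image_mset c u'" "u' \<subseteq># a"
  shows "\<exists>w'. (add_mset u w, add_mset u' w') \<in> (links (ms_factorizations preimage a) 2)\<^sup>* \<and>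
    image_mset (image_mset c) w' = image_mset (image_mset c) w"
  using assms
proof (induction "size (u' - u)" arbitrary: u w rule: less_induct)
  case less
  show ?case
  proof (cases "u' = u")
    case True
    then show ?thesis by blast
  next
    case False
    have sz: "size u = size u'" using less.prems(3) by (metis size_image_mset)
    have "\<not> u' \<subseteq># u"
      using False sz by (metis mset_subset_size nat_neq_iff subset_mset.less_le)
    then obtain p where p: "count u' p > count u p" by (auto simp: subseteq_mset_def not_le)
    \<comment> \<open>\<open>u\<close> and \<open>u'\<close> contain equally many primes of the class of \<open>p\<close>, with multiplicity.\<close>
    have "\<exists>q. c q = c p \<and> count u q > count u' q"
    proof (rule ccontr)
      assume no: "\<not> ?thesis"
      let ?f = "filter_mset (\<lambda>x. c x = c p)"
      have "?f u \<subset># ?f u'"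
      proof (rule subset_mset.le_neq_trans)
        show "?f u \<subseteq># ?f u'" using no by (auto simp: subseteq_mset_def not_less)
        have "count (?f u) p \<noteq> count (?f u') p" using p by simp
        then show "?f u \<noteq> ?f u'" by metis
      qed
      then have "size (?f u) < size (?f u')" by (rule mset_subset_size)
      moreover have "size (?f v) = count (image_mset c v) (c p)" for v
        by (induction v) auto
      ultimately show False using less.prems(3) by simp
    qed
    then obtain q where q: "c q = c p" "count u q > count u' q" by blast
    have "q \<noteq> p" using p q by auto
    have a: "a = u + \<Sum>\<^sub># w" using less.prems(1) by (auto simp: ms_factorizations_def)
    have "count u' p \<le> count a p" using less.prems(4) by (simp add: subseteq_mset_def)
    moreover have "count a p = count u p + count (\<Sum>\<^sub># w) p" using a by (simp only: count_union)
    ultimately have "count (\<Sum>\<^sub># w) p > 0" using p by linarith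
    then have "p \<in># \<Sum>\<^sub># w" by (simp only: count_greater_zero_iff)
    then obtain v w1 where v: "w = add_mset v w1" "p \<in># v"
      by (metis in_Union_mset_iff insert_DiffM)
    define u1 where "u1 = add_mset p (u - {#q#})"
    define v1 where "v1 = add_mset q (v - {#p#})"
    have qu: "q \<in># u" using q(2) by (metis count_greater_zero_iff gr_implies_not0 gr0I)
    have img: "image_mset c u1 = image_mset c u" "image_mset c v1 = image_mset c v"
      unfolding u1_def v1_def using q(1) v(2) qu
      by (metis image_mset_add_mset insert_DiffM)+
    have at: "u \<in> ms_atoms preimage" "v \<in> ms_atoms preimage" "set_mset w1 \<subseteq> ms_atoms preimage"
      using less.prems(1) v by (auto simp: ms_factorizations_def)
    have "p \<in> P" "q \<in> P" using at v(2) qu by (auto simp: atoms_iff)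
    then have at1: "u1 \<in> ms_atoms preimage" "v1 \<in> ms_atoms preimage"
      using at img by (auto simp: atoms_iff u1_def v1_def dest: in_diffD)
    have "u = add_mset q (u - {#q#})" "v = add_mset p (v - {#p#})" using v(2) qu by simp_all
    then have "u1 + v1 = u + v" unfolding u1_def v1_def
      by (metis add_mset_commute union_mset_add_mset_left union_mset_add_mset_right)
    then have fac: "add_mset u1 (add_mset v1 w1) \<in> ms_factorizations preimage a"
      using at1 at v a by (simp add: ms_factorizations_def flip: union_assoc)
    have "fdist (w1 + {#u, v#}) (w1 + {#u1, v1#}) \<le> 2"
      using fdist_le_max_size[of "{#u, v#}" "{#u1, v1#}"] by (simp only: fdist_add_left) simp
    then have "enat (fdist (add_mset u w) (add_mset u1 (add_mset v1 w1))) \<le> 2"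
      unfolding v(1) by (simp add: numeral_eq_enat)
    then have link: "(add_mset u w, add_mset u1 (add_mset v1 w1)) \<in> links (ms_factorizations preimage a) 2"
      using fac less.prems(1) by (simp add: links_def)
    have "u' - u1 = u' - u - {#p#}"
      unfolding u1_def using p q \<open>q \<noteq> p\<close> qu by (auto simp: multiset_eq_iff)
    moreover have "p \<in># u' - u" using p by (simp add: in_diff_count)
    ultimately have "size (u' - u1) < size (u' - u)"
      by (metis size_Diff1_less)
    from less.hyps[OF this fac less.prems(2) _ less.prems(4)] img less.prems(3)
    obtain w' where "(add_mset u1 (add_mset v1 w1), add_mset u' w') \<in> (links (ms_factorizations preimage a) 2)\<^sup>*"
       "image_mset (image_mset c) w' = image_mset (image_mset c) (add_mset v1 w1)" by auto
    with link img v(1) show ?thesis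
      by (intro exI[of _ w']) (auto intro: converse_rtrancl_into_rtrancl)
  qed
qed

lemma links_add:
  assumes "(z, z') \<in> (links (ms_factorizations preimage a) M)\<^sup>*" "u \<in> ms_factorizations preimage b"
  shows "(u + z, u + z') \<in> (links (ms_factorizations preimage (b + a)) M)\<^sup>*"
  using assms(1)
proof induction
  case (step y y')
  then have "(u + y, u + y') \<in> links (ms_factorizations preimage (b + a)) M"
    using assms(2) by (auto simp: links_def intro: ms_factorizations_add)
  with step show ?case by (blast intro: rtrancl_into_rtrancl)
qed simp

text \<open>
  One factor \<open>u'\<close> of \<open>z'\<close> at a time: the factor of \<open>z\<close> with the same image is transformed into \<open>u'\<close>,
  which is then cancelled.
\<close>

lemma fibre_chain:
  assumes "z \<in> ms_factorizations preimage a" "z' \<in> ms_factorizations preimage a"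
    and "image_mset (image_mset c) z = image_mset (image_mset c) z'"
  shows "(z, z') \<in> (links (ms_factorizations preimage a) 2)\<^sup>*"
  using assms
proof (induction z' arbitrary: z a)
  case empty
  then show ?case by simp
next
  case (add u' y')
  obtain u w where z: "z = add_mset u w" "image_mset c u = image_mset c u'"
    "image_mset (image_mset c) w = image_mset (image_mset c) y'"
    using msed_map_invR[of "image_mset c" z "image_mset c u'" "image_mset (image_mset c) y'"] add.prems(3)
    by auto
  have u': "u' \<in> ms_atoms preimage" "u' \<subseteq># a" "a = u' + \<Sum>\<^sub># y'" "set_mset y' \<subseteq> ms_atoms preimage"
    using add.prems(2) by (auto simp: ms_factorizations_def)
  obtain w' where w': "(add_mset u w, add_mset u' w') \<in> (links (ms_factorizations preimage a) 2)\<^sup>*"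
     "image_mset (image_mset c) w' = image_mset (image_mset c) y'"
    using exchange_to_atom[of u w a u'] add.prems z u' by metis
  have "add_mset u' w' \<in> ms_factorizations preimage a"
    using w'(1) add.prems(1) z(1) by (cases rule: rtranclE) (auto simp: links_def)
  then have "w' \<in> ms_factorizations preimage (\<Sum>\<^sub># y')" using u'(3) by (auto simp: ms_factorizations_def)
  moreover have "y' \<in> ms_factorizations preimage (\<Sum>\<^sub># y')" using u' by (simp add: ms_factorizations_def)
  ultimately have "(w', y') \<in> (links (ms_factorizations preimage (\<Sum>\<^sub># y')) 2)\<^sup>*"
    using add.IH w'(2) by blast
  from links_add[OF this, of "{#u'#}" u'] u'
  have "(add_mset u' w', add_mset u' y') \<in> (links (ms_factorizations preimage a) 2)\<^sup>*"
    by (simp add: ms_factorizations_def)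
  with w'(1) z(1) show ?case by auto
qed

text \<open>
  Only the part in which the two factorizations differ is replaced, so the lifted step is no longer
  than the given one.
\<close>

lemma lift_link:
  assumes z: "z \<in> ms_factorizations preimage a"
    and link: "(image_mset (image_mset c) z, Z') \<in> links (ms_factorizations B (image_mset c a)) M"
  shows "\<exists>z'. image_mset (image_mset c) z' = Z' \<and> (z, z') \<in> links (ms_factorizations preimage a) M"
proof -
  obtain X Y Y' where XY: "image_mset (image_mset c) z = X + Y" "Z' = X + Y'"
    "fdist (image_mset (image_mset c) z) Z' = max (size Y) (size Y')"
    using fdist_decomp by metis
  obtain x y where xy: "z = x + y" "image_mset (image_mset c) x = X" "image_mset (image_mset c) y = Y"
    using image_mset_eq_plusD[OF XY(1)] by auto
  have fy: "x \<in> ms_factorizations preimage (\<Sum>\<^sub># x)" "y \<in> ms_factorizations preimage (\<Sum>\<^sub># y)" "a = \<Sum>\<^sub># x + \<Sum>\<^sub># y"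
    using z xy(1) by (auto simp: ms_factorizations_def)
  have "\<Sum>\<^sub># X + \<Sum>\<^sub># Y = \<Sum>\<^sub># X + \<Sum>\<^sub># Y'" "set_mset Y' \<subseteq> ms_atoms B"
    using link XY(1,2) by (auto simp: links_def ms_factorizations_def)
  then have "Y' \<in> ms_factorizations B (image_mset c (\<Sum>\<^sub># y))"
    by (simp add: ms_factorizations_def image_Union xy)
  then obtain y' where y': "y' \<in> ms_factorizations preimage (\<Sum>\<^sub># y)" "image_mset (image_mset c) y' = Y'"
    using lift_factorization[of "\<Sum>\<^sub># y" Y'] preimage.ms_factorizations_mem[OF fy(2)] by auto
  have "fdist (x + y) (x + y') \<le> max (size y) (size y')"
    using fdist_le_max_size by simp
  also have "\<dots> = fdist (image_mset (image_mset c) z) Z'"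
    using XY(3) xy(3) y'(2) by auto
  also have "enat \<dots> \<le> M" using link by (simp add: links_def)
  finally have "enat (fdist z (x + y')) \<le> M" using xy(1) by simp
  moreover have "x + y' \<in> ms_factorizations preimage a"
    using fy y' ms_factorizations_add by blast
  ultimately show ?thesis using z xy XY y' by (intro exI[of _ "x + y'"]) (auto simp: links_def)
qed

text \<open>
  A chain between the images lifts step by step and ends in a factorization with the same image as
  \<open>z'\<close>; the remaining distance is covered inside the fibre, by steps of length two.
\<close>

lemma chained_lift_merged:
  assumes "a \<in> preimage" "chained (ms_factorizations B (image_mset c a)) M"
  shows "chained (ms_factorizations preimage a) (max M 2)"
  unfolding chained_def
proof (intro ballI)
  let ?I = "image_mset (image_mset c)"
  let ?Z = "ms_factorizations preimage a"
  fix z z' assume z: "z \<in> ?Z" "z' \<in> ?Z"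
  have mono: "(links ?Z M)\<^sup>* \<subseteq> (links ?Z (max M 2))\<^sup>*" "(links ?Z 2)\<^sup>* \<subseteq> (links ?Z (max M 2))\<^sup>*"
    by (auto intro!: rtrancl_mono simp: links_def le_max_iff_disj)
  have "\<exists>y. ?I y = Y \<and> y \<in> ?Z \<and> (z, y) \<in> (links ?Z M)\<^sup>*"
    if "(?I z, Y) \<in> (links (ms_factorizations B (image_mset c a)) M)\<^sup>*" for Y
    using that
  proof induction
    case base
    then show ?case using z by blast
  next
    case (step Y Y')
    then obtain y where "?I y = Y" "y \<in> ?Z" "(z, y) \<in> (links ?Z M)\<^sup>*" by blast
    moreover obtain y' where "?I y' = Y'" "(y, y') \<in> links ?Z M"
      using lift_link step.hyps(2) calculation by metis
    moreover have "y' \<in> ?Z" using calculation(5) by (simp add: links_def)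
    ultimately show ?case by (intro exI[of _ y']) (auto intro: rtrancl_into_rtrancl)
  qed
  moreover have "(?I z, ?I z') \<in> (links (ms_factorizations B (image_mset c a)) M)\<^sup>*"
    using assms(2) z by (simp add: chained_def image_factorization)
  ultimately obtain y where y: "?I y = ?I z'" "y \<in> ?Z" "(z, y) \<in> (links ?Z M)\<^sup>*" by blast
  with fibre_chain[of y a z'] z have "(y, z') \<in> (links ?Z 2)\<^sup>*" by blast
  with y mono show "(z, z') \<in> (links ?Z (max M 2))\<^sup>*"
    by (meson rtrancl_trans subsetD)
qed

text \<open>
  Both a multiple of \<open>u\<close> and a factorization of it can be chosen over the given data in \<open>B\<close>, and images
  do not increase distances.
\<close>

lemma tame_bound_image:
  assumes u: "u \<in> ms_atoms preimage" and tame: "tame_bound preimage u M"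
  shows "tame_bound B (image_mset c u) M"
  unfolding tame_bound_def
proof (intro ballI impI)
  fix S Z assume S: "S \<in> B" "\<exists>Z\<in>ms_factorizations B S. image_mset c u \<in># Z"
    and Z: "Z \<in> ms_factorizations B S"
  then obtain Y where Y: "add_mset (image_mset c u) Y \<in> ms_factorizations B S"
    by (metis insert_DiffM)
  then have Y': "Y \<in> ms_factorizations B (\<Sum>\<^sub># Y)" and SY: "S = image_mset c u + \<Sum>\<^sub># Y"
    by (auto simp: ms_factorizations_def)
  obtain b where b: "b \<in> preimage" "image_mset c b = \<Sum>\<^sub># Y"
    using lift_exists B.ms_factorizations_mem[OF Y'] by metis
  obtain y where "y \<in> ms_factorizations preimage b" using preimage.ms_factorizations_nonempty b by blast
  then have y: "add_mset u y \<in> ms_factorizations preimage (u + b)" using u by (simp add: ms_factorizations_def)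
  have img: "image_mset c (u + b) = S" using b SY by simp
  have ub: "u + b \<in> preimage" using y preimage.ms_factorizations_mem by blast
  then obtain z where z: "z \<in> ms_factorizations preimage (u + b)" "image_mset (image_mset c) z = Z"
    using lift_factorization Z img by metis
  then obtain z' where z': "z' \<in> ms_factorizations preimage (u + b)" "u \<in># z'" "enat (fdist z z') \<le> M"
    using tame ub y unfolding tame_bound_def by (metis union_single_eq_member)
  let ?Z' = "image_mset (image_mset c) z'"
  have "enat (fdist Z ?Z') \<le> M"
    using z z' fdist_image_le[of "image_mset c" z z'] by (metis enat_ord_simps(1) order_trans)
  then show "\<exists>Z'\<in>ms_factorizations B S. image_mset c u \<in># Z' \<and> enat (fdist Z Z') \<le> M"
    using z' image_factorization[OF z'(1)] img by (intro bexI[of _ ?Z']) auto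
qed

text \<open>For each prime of \<open>u\<close>, with multiplicity, one factor containing it is enough.\<close>

lemma covering_subfactorization:
  assumes "u \<subseteq># \<Sum>\<^sub># z"
  shows "\<exists>x. x \<subseteq># z \<and> u \<subseteq># \<Sum>\<^sub># x \<and> size x \<le> size u"
  using assms
proof (induction u)
  case empty
  then show ?case by (intro exI[of _ "{#}"]) auto
next
  case (add p u)
  then obtain x where x: "x \<subseteq># z" "u \<subseteq># \<Sum>\<^sub># x" "size x \<le> size u"
    using subset_mset.order_trans by (metis mset_subset_eq_add_right add_mset_add_single mset_subset_eq_add_left)
  show ?case
  proof (cases "add_mset p u \<subseteq># \<Sum>\<^sub># x")
    case True
    then show ?thesis using x by (intro exI[of _ x]) auto
  next
    case False
    obtain y where z: "z = x + y" using x(1) by (metis subset_mset.le_iff_add)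
    have "count (\<Sum>\<^sub># x) p = count u p"
      using False x(2) unfolding subseteq_mset_def by (metis Suc_leI count_add_mset le_neq_implies_less)
    moreover have "count (add_mset p u) p \<le> count (\<Sum>\<^sub># z) p"
      using add.prems by (simp add: subseteq_mset_def del: count_add_mset)
    ultimately have "p \<in># \<Sum>\<^sub># y"
      using z by (simp flip: count_greater_zero_iff)
    then obtain v y1 where v: "y = add_mset v y1" "p \<in># v"
      by (metis in_Union_mset_iff insert_DiffM)
    have "{#p#} + u \<subseteq># v + \<Sum>\<^sub># x"
      using v(2) x(2) by (intro subset_mset.add_mono) auto
    then show ?thesis using x z v by (intro exI[of _ "add_mset v x"]) auto
  qed
qed

text \<open>
  By \<open>covering_subfactorization\<close> a part \<open>x\<close> of \<open>z\<close> with at most \<open>size u\<close> factors is divisible by \<open>u\<close>.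
  The image of \<open>x\<close> can be replaced by a factorization that contains the image of \<open>u\<close> and is longer by at
  most \<open>M\<close>. Lifting its other factors to the quotient by \<open>u\<close> bounds the lengths on both sides,
  and with them the distance.
\<close>

lemma tame_bound_lift:
  assumes u: "u \<in> ms_atoms preimage" and tame: "tame_bound B (image_mset c u) (enat M)"
  shows "tame_bound preimage u (enat (size u + M))"
  unfolding tame_bound_def
proof (intro ballI impI)
  fix a z assume a: "a \<in> preimage" "\<exists>z\<in>ms_factorizations preimage a. u \<in># z"
    and z: "z \<in> ms_factorizations preimage a"
  have "u \<subseteq># a" using a(2) by (auto simp: ms_factorizations_def dest!: multi_member_split)
  then obtain x where x: "x \<subseteq># z" "u \<subseteq># \<Sum>\<^sub># x" "size x \<le> size u"
    using covering_subfactorization z by (metis (mono_tags, lifting) ms_factorizations_def mem_Collect_eq)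
  obtain y where zy: "z = x + y" using x(1) by (metis subset_mset.le_iff_add)
  have fx: "x \<in> ms_factorizations preimage (\<Sum>\<^sub># x)" "y \<in> ms_factorizations preimage (\<Sum>\<^sub># y)" "a = \<Sum>\<^sub># x + \<Sum>\<^sub># y"
    using z zy by (auto simp: ms_factorizations_def)
  obtain b where b: "\<Sum>\<^sub># x = u + b" using x(2) by (metis subset_mset.le_iff_add)
  have xA: "\<Sum>\<^sub># x \<in> preimage" using preimage.ms_factorizations_mem fx by blast
  have bA: "b \<in> preimage" using xA u b preimage.right_summand_mem ms_atomsD by metis
  let ?I = "image_mset (image_mset c)"
  obtain W where "W \<in> ms_factorizations B (image_mset c b)"
    using B.ms_factorizations_nonempty bA by (auto simp: preimage_iff)
  then have "add_mset (image_mset c u) W \<in> ms_factorizations B (image_mset c (\<Sum>\<^sub># x))"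
    using u b by (auto simp: ms_factorizations_def atoms_iff)
  moreover have "?I x \<in> ms_factorizations B (image_mset c (\<Sum>\<^sub># x))" using fx image_factorization by blast
  moreover have "image_mset c (\<Sum>\<^sub># x) \<in> B" using xA by (simp add: preimage_iff)
  ultimately obtain X' where X': "X' \<in> ms_factorizations B (image_mset c (\<Sum>\<^sub># x))"
    "image_mset c u \<in># X'" "fdist (?I x) X' \<le> M"
    using tame unfolding tame_bound_def by (metis enat_ord_simps(1) union_single_eq_member)
  obtain Y' where Y': "X' = add_mset (image_mset c u) Y'" using X'(2) by (metis insert_DiffM)
  have "Y' \<in> ms_factorizations B (image_mset c b)"
    using X'(1) b Y' by (auto simp: ms_factorizations_def)
  then obtain y' where y': "y' \<in> ms_factorizations preimage b" "?I y' = Y'"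
    using lift_factorization bA by metis
  let ?x' = "add_mset u y'"
  have fx': "?x' \<in> ms_factorizations preimage (\<Sum>\<^sub># x)" using y' b u by (auto simp: ms_factorizations_def)
  have "X' \<subseteq># ?I x + (X' - ?I x)" by (auto simp: subseteq_mset_def)
  then have "size X' \<le> size (?I x) + size (X' - ?I x)"
    by (metis size_mset_mono size_union)
  also have "\<dots> \<le> size u + M" using x(3) X'(3) by (auto simp: fdist_alt)
  finally have "size ?x' \<le> size u + M" using Y' y' by (metis size_add_mset size_image_mset)
  then have "fdist (y + x) (y + ?x') \<le> size u + M"
    unfolding fdist_add_left using fdist_le_max_size[of x ?x'] x(3) by linarith
  then show "\<exists>z'\<in>ms_factorizations preimage a. u \<in># z' \<and> enat (fdist z z') \<le> enat (size u + M)"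
    using fx fx' ms_factorizations_add[OF fx(2) fx'] zy
    by (intro bexI[of _ "y + ?x'"]) (auto simp: add.commute)
qed

lemma locally_tame_iff_merged:
  "(\<forall>u\<in>ms_atoms preimage. \<exists>M. tame_bound preimage u (enat M)) \<longleftrightarrow> (\<forall>U\<in>ms_atoms B. \<exists>M. tame_bound B U (enat M))"
proof
  assume L: "\<forall>u\<in>ms_atoms preimage. \<exists>M. tame_bound preimage u (enat M)"
  show "\<forall>U\<in>ms_atoms B. \<exists>M. tame_bound B U (enat M)"
  proof
    fix U assume U: "U \<in> ms_atoms B"
    then obtain u where "u \<in> preimage" "image_mset c u = U" using lift_exists ms_atomsD by metis
    then have "u \<in> ms_atoms preimage" using U by (auto simp: atoms_iff preimage_iff)
    with L tame_bound_image \<open>image_mset c u = U\<close> show "\<exists>M. tame_bound B U (enat M)" by metis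
  qed
next
  assume "\<forall>U\<in>ms_atoms B. \<exists>M. tame_bound B U (enat M)"
  then show "\<forall>u\<in>ms_atoms preimage. \<exists>M. tame_bound preimage u (enat M)"
    using tame_bound_lift atoms_iff by metis
qed

end


section \<open>Products of multisets and free monoids\<close>

context comm_monoid begin

lemma mset_prod_superset:
  assumes "finite F" "set_mset S \<subseteq> F" "F \<subseteq> carrier G"
  shows "mset_prod G S = (\<Otimes>g\<in>F. g [^] count S g)"
  unfolding mset_prod_def
  using assms by (intro finprod_mono_neutral_cong_left) (auto simp: not_in_iff Pi_iff subset_iff)

lemma mset_prod_empty [simp]: "mset_prod G {#} = \<one>"
  by (simp add: mset_prod_def)

lemma mset_prod_single: "x \<in> carrier G \<Longrightarrow> mset_prod G {#x#} = x"
  using mset_prod_superset[of "{x}" "{#x#}"] by simp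

lemma mset_prod_union:
  assumes "set_mset S \<subseteq> carrier G" "set_mset T \<subseteq> carrier G"
  shows "mset_prod G (S + T) = mset_prod G S \<otimes> mset_prod G T"
proof -
  let ?F = "set_mset S \<union> set_mset T"
  have "mset_prod G (S + T) = (\<Otimes>g\<in>?F. g [^] (count S g + count T g))"
    using assms mset_prod_superset[of ?F "S + T"] by simp
  also have "\<dots> = (\<Otimes>g\<in>?F. g [^] count S g \<otimes> g [^] count T g)"
    using assms by (intro finprod_cong') (auto simp: nat_pow_mult subset_iff)
  also have "\<dots> = (\<Otimes>g\<in>?F. g [^] count S g) \<otimes> (\<Otimes>g\<in>?F. g [^] count T g)"
    using assms by (intro finprod_multf) auto
  also have "\<dots> = mset_prod G S \<otimes> mset_prod G T"
    using assms by (simp add: mset_prod_superset[of ?F])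
  finally show ?thesis .
qed

lemma mset_prod_add_mset:
  "x \<in> carrier G \<Longrightarrow> set_mset S \<subseteq> carrier G \<Longrightarrow> mset_prod G (add_mset x S) = x \<otimes> mset_prod G S"
  using mset_prod_union[of "{#x#}" S] by (simp add: mset_prod_single)

lemma mset_prod_closed: "set_mset S \<subseteq> carrier G \<Longrightarrow> mset_prod G S \<in> carrier G"
  by (induction S) (auto simp: mset_prod_add_mset)

end

lemma free_monoid_simps [simp]:
  "carrier (free_monoid P) = {M. set_mset M \<subseteq> P}"
  "M \<otimes>\<^bsub>free_monoid P\<^esub> N = M + N"
  "\<one>\<^bsub>free_monoid P\<^esub> = {#}"
  by (simp_all add: free_monoid_def)

lemma comm_monoid_cancel_free_monoid: "comm_monoid_cancel (free_monoid P)"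
  by (rule comm_monoid_cancelI, unfold_locales) (auto simp: ac_simps)

lemma divides_free_monoid_iff:
  "set_mset N \<subseteq> P \<Longrightarrow> M divides\<^bsub>free_monoid P\<^esub> N \<longleftrightarrow> M \<subseteq># N"
  unfolding factor_def by (auto simp: subset_mset.le_iff_add)

section \<open>Monoids with a divisor homomorphism into a free monoid\<close>

lemma chained_iff_paths:
  "chained Z M \<longleftrightarrow> (\<forall>z\<in>Z. \<forall>z'\<in>Z. \<exists>(k::nat) f. f 0 = z \<and> f k = z' \<and> (\<forall>i\<le>k. f i \<in> Z) \<and>
     (\<forall>i<k. enat (fdist (f i) (f (Suc i))) \<le> M))" (is "_ \<longleftrightarrow> (\<forall>z\<in>Z. \<forall>z'\<in>Z. ?path z z')")
proof -
  have "?path z z' \<longleftrightarrow> (z, z') \<in> (links Z M)\<^sup>*" if z: "z \<in> Z" for z z'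
  proof
    assume "?path z z'"
    then obtain k f where "f 0 = z" "f k = z'" "\<forall>i<k. (f i, f (Suc i)) \<in> links Z M"
      by (auto simp: links_def less_imp_le Suc_le_eq)
    then show "(z, z') \<in> (links Z M)\<^sup>*"
      by (metis relpow_fun_conv relpow_imp_rtrancl)
  next
    assume "(z, z') \<in> (links Z M)\<^sup>*"
    then obtain k f where f: "f 0 = z" "f k = z'" "\<forall>i<k. (f i, f (Suc i)) \<in> links Z M"
      by (metis relpow_fun_conv rtrancl_imp_relpow)
    have "f i \<in> Z" if "i \<le> k" for i
      using f z that by (cases i) (auto simp: links_def Suc_le_eq)
    then show "?path z z'" using f by (intro exI[of _ k] exI[of _ f]) (auto simp: links_def)
  qed
  then show ?thesis by (auto simp: chained_def)
qed

lemma catenary_degree_elt_le_iff: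
  "catenary_degree_elt H a \<le> M \<longleftrightarrow> chained (factorizations H a) M"
proof -
  have *: "catenary_degree_elt H a = (LEAST M. chained (factorizations H a) M)"
    by (simp add: catenary_degree_elt_def chained_iff_paths)
  have "chained (factorizations H a) (catenary_degree_elt H a)"
    unfolding * by (rule LeastI, rule chained_infinity)
  then show ?thesis
    using chained_mono * by (metis Least_le)
qed

lemma catenary_degree_le_iff:
  "catenary_degree H \<le> M \<longleftrightarrow> (\<forall>a\<in>carrier H. chained (factorizations H a) M)"
  by (simp add: catenary_degree_def SUP_le_iff catenary_degree_elt_le_iff)

text \<open>
  An isometry is injective, so its inverse transports chains back.
\<close>

lemma chained_isometry:
  assumes "\<And>z z'. \<lbrakk>z \<in> Z; z' \<in> Z\<rbrakk> \<Longrightarrow> fdist (g z) (g z') = fdist z z'" "g ` Z = Z'"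
  shows "chained Z' M \<longleftrightarrow> chained Z M"
proof
  assume c: "chained Z' M"
  have "inj_on g Z"
  proof (rule inj_onI)
    fix z z' assume "z \<in> Z" "z' \<in> Z" "g z = g z'"
    then have "fdist z z' = 0" using assms(1)[of z z'] by (simp add: fdist_alt)
    then show "z = z'" by (auto simp: fdist_alt Diff_eq_empty_iff_mset)
  qed
  then show "chained Z M"
    using assms by (intro chained_image[OF c, of "the_inv_into Z g"])
     (auto simp: the_inv_into_onto the_inv_into_f_f)
qed (use assms chained_image in \<open>metis order_refl\<close>)

text \<open>
  The assumptions unfold \<open>divisor_hom\<close> for a free target, where divisibility is inclusion of multisets.
\<close>

locale free_divisor_hom = H: comm_monoid_cancel H
  for H :: "('a, 'm) monoid_scheme" (structure) and P :: "'p set" and \<phi> :: "'a \<Rightarrow> 'p multiset" +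
  assumes phi_mult [simp]: "\<lbrakk>a \<in> carrier H; b \<in> carrier H\<rbrakk> \<Longrightarrow> \<phi> (a \<otimes> b) = \<phi> a + \<phi> b"
    and phi_one [simp]: "\<phi> \<one> = {#}"
    and phi_closed: "a \<in> carrier H \<Longrightarrow> set_mset (\<phi> a) \<subseteq> P"
    and reflects_divides: "\<lbrakk>a \<in> carrier H; b \<in> carrier H; \<phi> a \<subseteq># \<phi> b\<rbrakk> \<Longrightarrow> a divides b"

lemma divisor_hom_free_iff: "divisor_hom H (free_monoid P) \<phi> \<longleftrightarrow> free_divisor_hom H P \<phi>"
proof
  assume h: "divisor_hom H (free_monoid P) \<phi>"
  then interpret comm_monoid_cancel H by (simp add: divisor_hom_def)
  show "free_divisor_hom H P \<phi>"
    using h by unfold_locales (auto simp: divisor_hom_def monoid_hom_def hom_def Pi_iff divides_free_monoid_iff)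
next
  assume "free_divisor_hom H P \<phi>"
  then interpret free_divisor_hom H P \<phi> .
  show "divisor_hom H (free_monoid P) \<phi>"
    unfolding divisor_hom_def monoid_hom_def hom_def
    using phi_closed reflects_divides
    by (auto simp: H.is_comm_monoid_cancel comm_monoid_cancel_free_monoid divides_free_monoid_iff)
qed

context free_divisor_hom begin

abbreviation im :: "'p multiset set" where "im \<equiv> \<phi> ` carrier H"

lemma quotient_exists:
  assumes "a \<in> carrier H" "b \<in> carrier H" "\<phi> a \<subseteq># \<phi> b"
  shows "\<exists>d\<in>carrier H. b = a \<otimes> d \<and> \<phi> b = \<phi> a + \<phi> d"
  using reflects_divides[OF assms] assms unfolding factor_def by auto

sublocale im: saturated_submonoid im
proof
  show "{#} \<in> im" using phi_one H.one_closed by (metis image_eqI)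
  show "a + b \<in> im" if "a \<in> im" "b \<in> im" for a b
    using that phi_mult H.m_closed by (smt (verit) image_iff)
  show "b - a \<in> im" if "a \<in> im" "b \<in> im" "a \<subseteq># b" for a b
  proof -
    obtain x where xy: "x \<in> carrier H" "a = \<phi> x" using \<open>a \<in> im\<close> by auto
    moreover obtain y where "y \<in> carrier H" "b = \<phi> y" using \<open>b \<in> im\<close> by auto
    ultimately obtain d where "d \<in> carrier H" "b = a + \<phi> d"
      using quotient_exists[of x y] \<open>a \<subseteq># b\<close> by auto
    then show ?thesis by simp
  qed
qed

lemma Units_iff: "a \<in> Units H \<longleftrightarrow> a \<in> carrier H \<and> \<phi> a = {#}"
proof
  assume a: "a \<in> Units H"
  then have "\<phi> a + \<phi> (inv a) = {#}"
    by (metis H.Units_closed H.Units_inv_closed H.Units_r_inv phi_mult phi_one)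
  then show "a \<in> carrier H \<and> \<phi> a = {#}" using a H.Units_closed by simp
next
  assume "a \<in> carrier H \<and> \<phi> a = {#}"
  then obtain d where "d \<in> carrier H" "\<one> = a \<otimes> d"
    using quotient_exists[of a \<one>] by auto
  then show "a \<in> Units H" using \<open>a \<in> carrier H \<and> _\<close> H.m_comm by (auto simp: Units_def)
qed

lemma same_image:
  assumes "a \<in> carrier H" "b \<in> carrier H" "\<phi> a = \<phi> b"
  shows "\<exists>e\<in>Units H. b = a \<otimes> e"
proof -
  have "\<phi> a \<subseteq># \<phi> b" using assms(3) by simp
  then obtain e where "e \<in> carrier H" "b = a \<otimes> e" "\<phi> b = \<phi> a + \<phi> e"
    using quotient_exists[of a b] assms(1,2) by blast
  then show ?thesis using assms(3) by (intro bexI[of _ e]) (auto simp: Units_iff)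
qed

lemma atoms_iff: "u \<in> atoms H \<longleftrightarrow> u \<in> carrier H \<and> \<phi> u \<in> ms_atoms im"
proof
  assume u: "u \<in> atoms H"
  have "\<phi> b = {#} \<or> \<phi> d = {#}" if bd: "b \<in> carrier H" "d \<in> carrier H" "\<phi> u = \<phi> b + \<phi> d" for b d
  proof -
    obtain d' where "d' \<in> carrier H" "u = b \<otimes> d'" "\<phi> u = \<phi> b + \<phi> d'"
      using u bd quotient_exists[of b u] by (auto simp: atoms_def)
    moreover have "\<phi> d' = \<phi> d" using bd(3) calculation(3) by simp
    moreover have "b \<in> Units H \<or> d' \<in> Units H" using u bd(1) calculation unfolding atoms_def by blast
    ultimately show ?thesis by (auto simp: Units_iff)
  qed
  then show "u \<in> carrier H \<and> \<phi> u \<in> ms_atoms im"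
    using u by (auto simp: ms_atoms_def atoms_def Units_iff)
next
  assume "u \<in> carrier H \<and> \<phi> u \<in> ms_atoms im"
  then show "u \<in> atoms H" by (auto simp: ms_atoms_def atoms_def Units_iff)
qed

lemma unit_cancellative_H: "unit_cancellative H"
  unfolding unit_cancellative_def by (auto simp: Units_iff) (metis add_cancel_right_right phi_mult)

lemma foldr_closed: "set us \<subseteq> carrier H \<Longrightarrow> foldr (\<otimes>) us \<one> \<in> carrier H"
  by (induction us) auto

lemma hom_foldr: "set us \<subseteq> carrier H \<Longrightarrow> \<phi> (foldr (\<otimes>) us \<one>) = sum_list (map \<phi> us)"
  by (induction us) (auto simp: foldr_closed)

text \<open>
  A decomposition of \<open>\<phi> a\<close> is peeled off \<open>a\<close> one summand at a time; the last factor absorbs the unit,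
  so at least one summand is needed.
\<close>

lemma lift_list:
  assumes "a \<in> carrier H" "ms \<noteq> []" "set ms \<subseteq> im" "\<phi> a = sum_list ms"
  shows "\<exists>us. set us \<subseteq> carrier H \<and> map \<phi> us = ms \<and> foldr (\<otimes>) us \<one> = a"
  using assms
proof (induction ms arbitrary: a)
  case Nil
  then show ?case by simp
next
  case (Cons m ms)
  show ?case
  proof (cases "ms = []")
    case True
    then show ?thesis using Cons.prems by (intro exI[of _ "[a]"]) auto
  next
    case False
    obtain u where u: "u \<in> carrier H" "m = \<phi> u" using Cons.prems(3) by auto
    then obtain b where b: "b \<in> carrier H" "a = u \<otimes> b" "\<phi> a = \<phi> u + \<phi> b"
      using quotient_exists[of u a] Cons.prems by auto
    then have "\<phi> b = sum_list ms" using Cons.prems(4) u by simp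
    then obtain us where "set us \<subseteq> carrier H" "map \<phi> us = ms" "foldr (\<otimes>) us \<one> = b"
      using Cons.IH[OF b(1) False] Cons.prems(3) by auto
    then show ?thesis using u b by (intro exI[of _ "u # us"]) auto
  qed
qed

lemma lift_atom_list:
  assumes "a \<in> carrier H - Units H" "z \<in> ms_factorizations im (\<phi> a)"
  shows "\<exists>us. set us \<subseteq> atoms H \<and> foldr (\<otimes>) us \<one> = a \<and> length us = size z"
proof -
  obtain ms where ms: "z = mset ms" by (metis ex_mset)
  have "sum_list ms = \<phi> a" "set ms \<subseteq> ms_atoms im"
    using assms(2) ms by (auto simp: ms_factorizations_def sum_mset_sum_list)
  moreover have "ms \<noteq> []" using assms(1) calculation(1) by (auto simp: Units_iff)
  moreover have "set ms \<subseteq> im" using calculation(2) by (auto simp: ms_atoms_def)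
  ultimately obtain us where us: "set us \<subseteq> carrier H" "map \<phi> us = ms" "foldr (\<otimes>) us \<one> = a"
    using lift_list[of a ms] assms(1) by auto
  have "\<phi> u \<in> ms_atoms im" if "u \<in> set us" for u
    using that us(2) \<open>set ms \<subseteq> ms_atoms im\<close> by (metis imageI set_map subsetD)
  then have "set us \<subseteq> atoms H" using us by (auto simp: atoms_iff)
  then show ?thesis using us ms by (intro exI[of _ us]) auto
qed

lemma atomic_H: "atomic H"
  unfolding atomic_def using lift_atom_list im.ms_factorizations_nonempty by (metis DiffD1 all_not_in_conv imageI)

lemma length_set_eq:
  assumes a: "a \<in> carrier H"
  shows "length_set H a = size ` ms_factorizations im (\<phi> a)"
proof (cases "a \<in> Units H")
  case True
  then show ?thesis by (simp add: length_set_def Units_iff ms_factorizations_empty)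
next
  case False
  have "length us \<in> size ` ms_factorizations im (\<phi> a)" if "set us \<subseteq> atoms H" "foldr (\<otimes>) us \<one> = a" for us
  proof -
    have "set us \<subseteq> carrier H" using that(1) by (auto simp: atoms_def)
    then have "sum_list (map \<phi> us) = \<phi> a" using hom_foldr that(2) by metis
    then have "mset (map \<phi> us) \<in> ms_factorizations im (\<phi> a)"
      using that(1) by (auto simp: ms_factorizations_def atoms_iff sum_mset_sum_list simp del: mset_map)
    then show ?thesis by (metis image_eqI length_map size_mset)
  qed
  moreover have "\<exists>us. n = length us \<and> set us \<subseteq> atoms H \<and> foldr (\<otimes>) us \<one> = a"
    if n: "n \<in> size ` ms_factorizations im (\<phi> a)" for n
  proof -
    obtain z where "z \<in> ms_factorizations im (\<phi> a)" "n = size z" using n by blast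
    then show ?thesis using lift_atom_list[of a z] a False by (metis DiffI)
  qed
  ultimately show ?thesis using False by (auto simp: length_set_def)
qed

abbreviation coset :: "'a \<Rightarrow> 'a set" where "coset a \<equiv> a <# Units H"
abbreviation R :: "'a set monoid" where "R \<equiv> reduced_monoid H"

text \<open>
  \<open>\<phi>\<close> is constant on the cosets of the units and separates them, so the value of a coset identifies
  the reduced monoid with the image of \<open>\<phi>\<close>.
\<close>

definition coset_value :: "'a set \<Rightarrow> 'p multiset" where "coset_value C = the_elem (\<phi> ` C)"

lemma coset_eq: "a \<in> carrier H \<Longrightarrow> coset a = {b \<in> carrier H. \<phi> b = \<phi> a}"
  unfolding l_coset_def
  by (auto simp: Units_iff) (metis (no_types, lifting) same_image Units_iff)

lemma coset_value_coset [simp]: "a \<in> carrier H \<Longrightarrow> coset_value (coset a) = \<phi> a"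
proof -
  assume a: "a \<in> carrier H"
  then have "\<phi> ` coset a = {\<phi> a}" by (auto simp: coset_eq)
  then show ?thesis by (simp add: coset_value_def)
qed

lemma coset_eq_iff: "a \<in> carrier H \<Longrightarrow> b \<in> carrier H \<Longrightarrow> coset a = coset b \<longleftrightarrow> \<phi> a = \<phi> b"
  by (metis coset_eq coset_value_coset)

lemma coset_mult: "a \<in> carrier H \<Longrightarrow> b \<in> carrier H \<Longrightarrow> coset a <#> coset b = coset (a \<otimes> b)"
proof -
  assume ab: "a \<in> carrier H" "b \<in> carrier H"
  have "x \<in> coset a <#> coset b" if x: "x \<in> carrier H" "\<phi> x = \<phi> a + \<phi> b" for x
  proof -
    obtain d where "d \<in> carrier H" "x = a \<otimes> d" "\<phi> x = \<phi> a + \<phi> d"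
      using quotient_exists[of a x] x ab by auto
    then show ?thesis using x ab unfolding set_mult_def by (auto simp: coset_eq)
  qed
  then show ?thesis using ab by (auto simp: coset_eq set_mult_def)
qed

lemma Units_eq_coset: "Units H = coset \<one>"
  by (auto simp: coset_eq Units_iff)

lemma reduced_simps:
  "carrier R = coset ` carrier H" "\<one>\<^bsub>R\<^esub> = coset \<one>"
  "C \<otimes>\<^bsub>R\<^esub> D = C <#> D"
  using Units_eq_coset by (simp_all add: reduced_monoid_def)

sublocale R: comm_monoid R
  by unfold_locales (auto simp: reduced_simps coset_mult H.m_ac)

lemma coset_in_Units_R: "a \<in> carrier H \<Longrightarrow> coset a \<in> Units R \<longleftrightarrow> \<phi> a = {#}"
proof
  assume "coset a \<in> Units R" and a: "a \<in> carrier H"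
  then obtain b where "b \<in> carrier H" "coset a <#> coset b = coset \<one>"
    unfolding Units_def[of R] by (auto simp: reduced_simps)
  with a have "\<phi> (a \<otimes> b) = {#}" by (simp add: coset_mult coset_eq_iff)
  then show "\<phi> a = {#}" using a \<open>b \<in> carrier H\<close> by simp
next
  assume "\<phi> a = {#}" "a \<in> carrier H"
  then have "coset a = \<one>\<^bsub>R\<^esub>" by (simp add: reduced_simps coset_eq_iff)
  then show "coset a \<in> Units R" by simp
qed

lemma coset_atom_iff: "a \<in> carrier H \<Longrightarrow> coset a \<in> atoms R \<longleftrightarrow> \<phi> a \<in> ms_atoms im"
proof -
  assume a: "a \<in> carrier H"
  have "coset a \<in> atoms R \<longleftrightarrow> coset a \<notin> Units R \<and> (\<forall>b\<in>carrier H. \<forall>d\<in>carrier H.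
      coset a = coset b <#> coset d \<longrightarrow> coset b \<in> Units R \<or> coset d \<in> Units R)"
    using a unfolding atoms_def reduced_simps by blast
  also have "\<dots> \<longleftrightarrow> \<phi> a \<noteq> {#} \<and> (\<forall>b\<in>carrier H. \<forall>d\<in>carrier H.
      \<phi> a = \<phi> b + \<phi> d \<longrightarrow> \<phi> b = {#} \<or> \<phi> d = {#})"
    using a by (simp add: coset_in_Units_R coset_mult coset_eq_iff)
  also have "\<dots> \<longleftrightarrow> \<phi> a \<in> ms_atoms im" using a by (simp add: ms_atoms_def)
  finally show ?thesis .
qed

lemma atoms_R_subset: "atoms R \<subseteq> carrier R"
  by (auto simp: atoms_def)

lemma atoms_R_eq: "coset_value ` atoms R = ms_atoms im"
proof -
  have "u \<in> coset_value ` atoms R" if u: "u \<in> ms_atoms im" for u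
  proof -
    obtain a where a: "a \<in> carrier H" "u = \<phi> a" using ms_atomsD(1)[OF u] by auto
    then show ?thesis using u coset_atom_iff[OF a(1)] by (intro image_eqI[of _ _ "coset a"]) auto
  qed
  moreover have "coset_value C \<in> ms_atoms im" if C: "C \<in> atoms R" for C
  proof -
    obtain a where "a \<in> carrier H" "C = coset a"
      using C atoms_R_subset by (auto simp: reduced_simps)
    then show ?thesis using C coset_atom_iff by auto
  qed
  ultimately show ?thesis by blast
qed

lemma inj_on_coset_value: "inj_on coset_value (carrier R)"
  by (auto simp: inj_on_def reduced_simps coset_eq_iff)

lemma coset_value_mset_prod:
  "set_mset z \<subseteq> carrier R \<Longrightarrow> coset_value (mset_prod R z) = \<Sum>\<^sub># (image_mset coset_value z)"
proof (induction z)
  case empty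
  then show ?case by (simp add: reduced_simps)
next
  case (add C z)
  then have "mset_prod R z \<in> carrier R" "C \<in> carrier R" using R.mset_prod_closed[of z] by auto
  then obtain a b where "a \<in> carrier H" "b \<in> carrier H" "mset_prod R z = coset b" "C = coset a"
    by (auto simp: reduced_simps)
  then show ?case using add by (simp add: R.mset_prod_add_mset) (simp add: reduced_simps coset_mult)
qed

lemma factorizations_iff:
  assumes a: "a \<in> carrier H"
  shows "z \<in> factorizations H a \<longleftrightarrow> set_mset z \<subseteq> atoms R \<and>
    \<Sum>\<^sub># (image_mset coset_value z) = \<phi> a"
proof (cases "set_mset z \<subseteq> atoms R")
  case True
  then have z: "set_mset z \<subseteq> carrier R" using atoms_R_subset by blast
  then have "mset_prod R z = coset a \<longleftrightarrow> coset_value (mset_prod R z) = coset_value (coset a)"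
    using inj_on_coset_value a R.mset_prod_closed by (metis imageI inj_on_eq_iff reduced_simps(1))
  then show ?thesis using True a z
    by (simp add: factorizations_def factorization_monoid_def coset_value_mset_prod)
qed (simp add: factorizations_def factorization_monoid_def)

lemma image_factorizations:
  assumes "a \<in> carrier H"
  shows "image_mset coset_value ` factorizations H a = ms_factorizations im (\<phi> a)"
proof -
  have "image_mset coset_value z \<in> ms_factorizations im (\<phi> a)" if "z \<in> factorizations H a" for z
    using that assms atoms_R_eq by (auto simp: ms_factorizations_def factorizations_iff)
  moreover have "z \<in> image_mset coset_value ` factorizations H a" if z: "z \<in> ms_factorizations im (\<phi> a)" for z
  proof -
    have sub: "set_mset z \<subseteq> coset_value ` atoms R" using z atoms_R_eq by (auto simp: ms_factorizations_def)
    let ?y = "image_mset (inv_into (atoms R) coset_value) z"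
    have "image_mset (coset_value \<circ> inv_into (atoms R) coset_value) z = image_mset id z"
      using sub by (intro image_mset_cong) (auto simp: f_inv_into_f subset_iff)
    then have y: "image_mset coset_value ?y = z" by (simp add: image_mset.compositionality)
    moreover have "set_mset ?y \<subseteq> atoms R" using sub by (auto intro: inv_into_into)
    ultimately have "?y \<in> factorizations H a"
      using z assms by (simp only: factorizations_iff) (simp add: ms_factorizations_def)
    then show ?thesis using y by (metis imageI)
  qed
  ultimately show ?thesis by blast
qed

lemma factorizations_isometry:
  assumes "a \<in> carrier H" "z \<in> factorizations H a" "z' \<in> factorizations H a"
  shows "fdist (image_mset coset_value z) (image_mset coset_value z') = fdist z z'"
  using assms atoms_R_subset
  by (intro fdist_image_inj inj_on_subset[OF inj_on_coset_value]) (auto simp: factorizations_iff)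

lemma catenary_degree_le_iff_im: "catenary_degree H \<le> M \<longleftrightarrow> (\<forall>s\<in>im. chained (ms_factorizations im s) M)"
  using chained_isometry[OF factorizations_isometry image_factorizations]
  by (simp add: catenary_degree_le_iff)

lemma length_system_eq: "length_system H = (\<lambda>s. size ` ms_factorizations im s) ` im"
  unfolding length_system_def image_image by (rule image_cong) (simp_all add: length_set_eq)

lemma factorizations_through_iff:
  assumes "a \<in> carrier H" "C \<in> atoms R"
  shows "z \<in> factorizations_through H C a \<longleftrightarrow> z \<in> factorizations H a \<and> C \<in># z"
  using assms
  by (auto simp: factorizations_through_def factorization_monoid_def factorizations_iff dest!: multi_member_split)

lemma tame_degree_le_iff:
  assumes C: "C \<in> atoms R"
  shows "tame_degree H C \<le> M \<longleftrightarrow> tame_bound im (coset_value C) M"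
proof -
  let ?Q = "\<lambda>M. \<forall>a\<in>carrier H. factorizations_through H C a \<noteq> {} \<longrightarrow>
       (\<forall>z\<in>factorizations H a. \<exists>z'\<in>factorizations_through H C a. enat (fdist z z') \<le> M)"
  have mem: "coset_value C \<in> coset_value ` set_mset z \<longleftrightarrow> C \<in># z"
    if "z \<in> factorizations H a" "a \<in> carrier H" for z a
  proof
    assume "coset_value C \<in> coset_value ` set_mset z"
    then obtain D where "D \<in># z" "coset_value D = coset_value C" by auto
    moreover then have "D \<in> carrier R" using that atoms_R_subset by (auto simp: factorizations_iff)
    ultimately show "C \<in># z" using C atoms_R_subset inj_on_coset_value by (auto dest: inj_onD)
  qed simp
  have Q: "?Q M \<longleftrightarrow> tame_bound im (coset_value C) M" for M
  proof -
    have "(factorizations_through H C a \<noteq> {} \<longrightarrow>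
       (\<forall>z\<in>factorizations H a. \<exists>z'\<in>factorizations_through H C a. enat (fdist z z') \<le> M)) \<longleftrightarrow>
      ((\<exists>z\<in>ms_factorizations im (\<phi> a). coset_value C \<in># z) \<longrightarrow>
     (\<forall>z\<in>ms_factorizations im (\<phi> a). \<exists>z'\<in>ms_factorizations im (\<phi> a).
        coset_value C \<in># z' \<and> enat (fdist z z') \<le> M))" if a: "a \<in> carrier H" for a
    proof -
      have through: "factorizations_through H C a = {z \<in> factorizations H a. C \<in># z}"
        using factorizations_through_iff[OF a C] by auto
      show ?thesis
        unfolding through image_factorizations[OF a, symmetric]
        by (auto simp: mem[OF _ a] factorizations_isometry[OF a])
    qed
    then show ?thesis by (simp add: tame_bound_def)
  qed
  have t: "tame_degree H C = (LEAST M. ?Q M)" by (simp add: tame_degree_def)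
  have inf: "tame_bound im (coset_value C) \<infinity>"
    by (auto simp: tame_bound_def)
  have "tame_bound im (coset_value C) (tame_degree H C)"
    unfolding t Q using inf by (rule LeastI)
  moreover have "tame_degree H C \<le> M" if "tame_bound im (coset_value C) M"
    unfolding t using that Q[of M] by (intro Least_le) blast
  ultimately show ?thesis using tame_bound_mono by blast
qed

lemma locally_tame_iff_im: "locally_tame H \<longleftrightarrow> (\<forall>u\<in>ms_atoms im. \<exists>M. tame_bound im u (enat M))"
proof -
  have "tame_degree H C < \<infinity> \<longleftrightarrow> (\<exists>M. tame_bound im (coset_value C) (enat M))" if "C \<in> atoms R" for C
  proof -
    have "tame_degree H C < \<infinity> \<longleftrightarrow> (\<exists>M. tame_degree H C \<le> enat M)"
      by (metis enat_ord_code(4) enat_ord_simps(4) le_less_trans not_infinity_eq order_refl)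
    then show ?thesis using tame_degree_le_iff[OF that] by simp
  qed
  then show ?thesis by (simp add: locally_tame_def flip: atoms_R_eq)
qed

end


section \<open>Classes of multisets of primes\<close>

lemma lookup_mset_frag: "Poly_Mapping.lookup (mset_frag M) p = int (count M p)"
  unfolding mset_frag_def
  by (induction M) (auto simp: lookup_add lookup_single when_def)

lemma mset_frag_simps [simp]:
  "mset_frag {#} = 0" "mset_frag (M + N) = mset_frag M + mset_frag N" "mset_frag {#p#} = frag_of p"
  by (simp_all add: mset_frag_def)

lemma mset_frag_eq_iff [simp]: "mset_frag M = mset_frag N \<longleftrightarrow> M = N"
  by (metis lookup_mset_frag multiset_eq_iff of_nat_eq_iff)

lemma keys_mset_frag [simp]: "Poly_Mapping.keys (mset_frag M) = set_mset M"
  by (auto simp: in_keys_iff lookup_mset_frag)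

lemma cofinal_free_iff:
  "cofinal H (free_monoid P) \<phi> \<longleftrightarrow> (\<forall>M. set_mset M \<subseteq> P \<longrightarrow> (\<exists>u\<in>carrier H. set_mset (\<phi> u) \<subseteq> P \<and> M \<subseteq># \<phi> u))"
proof -
  have "(\<exists>u\<in>carrier H. M divides\<^bsub>free_monoid P\<^esub> \<phi> u) \<longleftrightarrow> (\<exists>u\<in>carrier H. set_mset (\<phi> u) \<subseteq> P \<and> M \<subseteq># \<phi> u)"
    if "set_mset M \<subseteq> P" for M
    using that unfolding factor_def by (intro bex_cong refl) (auto simp: subset_mset.le_iff_add)
  then show ?thesis unfolding cofinal_def by auto
qed

context free_divisor_hom begin

abbreviation "FA \<equiv> free_Abelian_group P"
abbreviation "N \<equiv> quotients_of_image H \<phi>"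
abbreviation "Cl \<equiv> class_group H P \<phi>"

definition mset_class :: "'p multiset \<Rightarrow> ('p \<Rightarrow>\<^sub>0 int) set" where
  "mset_class M = N #>\<^bsub>FA\<^esub> mset_frag M"

lemma quotients_subgroup: "subgroup N FA"
proof (rule group.subgroupI)
  show "N \<subseteq> carrier FA"
    using phi_closed by (fastforce simp: quotients_of_image_def dest!: keys_diff[THEN subsetD])
  show "N \<noteq> {}" using H.one_closed by (auto simp: quotients_of_image_def)
  show "inv\<^bsub>FA\<^esub> x \<in> N" if x: "x \<in> N" for x
  proof -
    obtain a b where ab: "a \<in> carrier H" "b \<in> carrier H" "x = mset_frag (\<phi> a) - mset_frag (\<phi> b)"
      using x by (auto simp: quotients_of_image_def)
    have "x \<in> carrier FA" using x \<open>N \<subseteq> carrier FA\<close> by blast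
    then have "inv\<^bsub>FA\<^esub> x = mset_frag (\<phi> b) - mset_frag (\<phi> a)" using ab by simp
    then show ?thesis using ab unfolding quotients_of_image_def by blast
  qed
  show "x \<otimes>\<^bsub>FA\<^esub> y \<in> N" if xy: "x \<in> N" "y \<in> N" for x y
  proof -
    obtain a b where ab: "a \<in> carrier H" "b \<in> carrier H" "x = mset_frag (\<phi> a) - mset_frag (\<phi> b)"
      using xy by (auto simp: quotients_of_image_def)
    obtain d e where de: "d \<in> carrier H" "e \<in> carrier H" "y = mset_frag (\<phi> d) - mset_frag (\<phi> e)"
      using xy by (auto simp: quotients_of_image_def)
    have "x \<otimes>\<^bsub>FA\<^esub> y = mset_frag (\<phi> (a \<otimes> d)) - mset_frag (\<phi> (b \<otimes> e))"
      using ab de by simp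
    then show ?thesis using ab de unfolding quotients_of_image_def by blast
  qed
qed simp

lemma quotients_diff: "x \<in> N \<Longrightarrow> y \<in> N \<Longrightarrow> x - y \<in> N"
  using subgroup.m_closed[OF quotients_subgroup] subgroup.m_inv_closed[OF quotients_subgroup]
  subgroup.subset[OF quotients_subgroup]
  by (metis carrier_free_Abelian_group_iff diff_conv_add_uminus inv_free_Abelian_group mult_free_Abelian_group subsetD)

lemma quotients_normal: "N \<lhd> FA"
  by (rule comm_group.subgroup_imp_normal[OF abelian_free_Abelian_group quotients_subgroup])

lemma comm_group_Cl: "comm_group Cl"
  unfolding class_group_def
  by (rule comm_group.abelian_FactGroup[OF abelian_free_Abelian_group quotients_subgroup])

lemma one_Cl: "\<one>\<^bsub>Cl\<^esub> = N"
  by (simp add: class_group_def)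

text \<open>
  A multiset that is a quotient of elements of the image lies in the image, since \<open>\<phi>\<close> reflects divisibility.
\<close>

lemma mset_frag_in_quotients: "set_mset M \<subseteq> P \<Longrightarrow> mset_frag M \<in> N \<longleftrightarrow> M \<in> im"
proof
  assume "mset_frag M \<in> N"
  then obtain a b where ab: "a \<in> carrier H" "b \<in> carrier H" "mset_frag M = mset_frag (\<phi> a) - mset_frag (\<phi> b)"
    by (auto simp: quotients_of_image_def)
  then have "mset_frag (\<phi> b + M) = mset_frag (\<phi> a)" by simp
  then have "\<phi> b + M = \<phi> a" by (simp only: mset_frag_eq_iff)
  then show "M \<in> im" using ab im.right_summand_mem by (metis imageI)
next
  assume "M \<in> im"
  then obtain a where "a \<in> carrier H" "M = \<phi> a" by auto
  then show "mset_frag M \<in> N"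
    unfolding quotients_of_image_def by (intro CollectI exI[of _ a] exI[of _ \<one>]) auto
qed

lemma mset_class_closed: "set_mset M \<subseteq> P \<Longrightarrow> mset_class M \<in> carrier Cl"
  by (auto simp: mset_class_def class_group_def carrier_FactGroup)

lemma mset_class_add:
  "set_mset M \<subseteq> P \<Longrightarrow> set_mset M' \<subseteq> P \<Longrightarrow> mset_class (M + M') = mset_class M \<otimes>\<^bsub>Cl\<^esub> mset_class M'"
  unfolding mset_class_def class_group_def
  using normal.rcos_sum[OF quotients_normal, of "mset_frag M" "mset_frag M'"] by simp

lemma mset_class_single: "mset_class {#p#} = prime_class H P \<phi> p"
  by (simp add: mset_class_def prime_class_def)

lemma mset_class_eq_one_iff: "set_mset M \<subseteq> P \<Longrightarrow> mset_class M = \<one>\<^bsub>Cl\<^esub> \<longleftrightarrow> M \<in> im"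
proof -
  assume M: "set_mset M \<subseteq> P"
  then have "mset_frag M \<in> carrier FA" by simp
  then have "mset_class M = N \<longleftrightarrow> mset_frag M \<in> N"
    unfolding mset_class_def
    using group.rcos_self[OF group_free_Abelian_group] quotients_subgroup
      subgroup.rcos_const[OF quotients_subgroup group_free_Abelian_group] by metis
  then show ?thesis using M mset_frag_in_quotients by (simp add: one_Cl)
qed

lemma mset_class_empty: "mset_class {#} = \<one>\<^bsub>Cl\<^esub>"
  using im.zero_mem by (simp add: mset_class_eq_one_iff)

text \<open>By cofinality the inverse of the class of a multiset is again the class of a multiset.\<close>

lemma mset_class_surj:
  assumes cof: "cofinal H (free_monoid P) \<phi>" and X: "X \<in> carrier Cl"
  shows "\<exists>M. set_mset M \<subseteq> P \<and> X = mset_class M"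
proof -
  obtain x where x: "Poly_Mapping.keys x \<subseteq> P" "X = N #>\<^bsub>FA\<^esub> x"
    using X by (auto simp: class_group_def carrier_FactGroup)
  have "\<exists>M. set_mset M \<subseteq> P \<and> x - mset_frag M \<in> N"
  proof (rule free_Abelian_group_induct[OF x(1)], goal_cases)
    case 1
    have "0 \<in> N" using subgroup.one_closed[OF quotients_subgroup] by simp
    then show ?case by (intro exI[of _ "{#}"]) simp
  next
    case (2 x y)
    then obtain M M' where M: "set_mset M \<subseteq> P" "x - mset_frag M \<in> N" "set_mset M' \<subseteq> P" "y - mset_frag M' \<in> N"
      by blast
    then obtain u where "u \<in> carrier H" "set_mset (\<phi> u) \<subseteq> P" "M' \<subseteq># \<phi> u" using cof unfolding cofinal_free_iff by blast
    then obtain M'' where M'': "\<phi> u = M' + M''" "set_mset M'' \<subseteq> P"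
      by (metis le_sup_iff set_mset_union subset_mset.le_iff_add)
    have "mset_frag (\<phi> u) \<in> N"
      using \<open>u \<in> carrier H\<close> \<open>set_mset (\<phi> u) \<subseteq> P\<close> mset_frag_in_quotients by blast
    then have "(x - mset_frag M) - (y - mset_frag M') - mset_frag (\<phi> u) \<in> N"
      using M quotients_diff by blast
    also have "(x - mset_frag M) - (y - mset_frag M') - mset_frag (\<phi> u) = (x - y) - mset_frag (M + M'')"
      unfolding M''(1) by simp
    finally show ?case using M M'' by (intro exI[of _ "M + M''"]) auto
  next
    case (3 p)
    have "0 \<in> N" using subgroup.one_closed[OF quotients_subgroup] by simp
    then show ?case using 3 by (intro exI[of _ "{#p#}"]) simp
  qed
  then obtain M where M: "set_mset M \<subseteq> P" "x - mset_frag M \<in> N" by blast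
  then have "x \<in> N #>\<^bsub>FA\<^esub> mset_frag M"
    unfolding r_coset_def by (intro UN_I[OF M(2)]) simp
  then have "X = mset_class M"
    unfolding x(2) mset_class_def
    using group.repr_independence[OF group_free_Abelian_group, of x P N "mset_frag M"] quotients_subgroup M(1)
    by simp
  then show ?thesis using M by blast
qed

text \<open>Via an isomorphism \<open>\<iota>\<close>, the class of a multiset is the sum of the classes of its primes.\<close>

lemma mset_prod_classes:
  assumes "comm_group G" "\<iota> \<in> iso Cl G" "set_mset M \<subseteq> P"
  shows "mset_prod G (image_mset (\<lambda>p. \<iota> (prime_class H P \<phi> p)) M) = \<iota> (mset_class M)"
proof -
  interpret G: comm_group G by fact
  interpret Cl: comm_group Cl by (rule comm_group_Cl)
  have hom: "\<iota> \<in> hom Cl G" using assms(2) by (simp add: iso_def)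
  have cl: "\<iota> (prime_class H P \<phi> q) \<in> carrier G" if "q \<in> P" for q
    using hom_in_carrier[OF hom] mset_class_closed[of "{#q#}"] that by (simp add: mset_class_single)
  show ?thesis
    using assms(3)
  proof (induction M)
    case empty
    then show ?case
      using hom_one[OF hom Cl.is_group G.is_group] by (simp add: mset_class_empty)
  next
    case (add p M)
    have "mset_prod G (image_mset (\<lambda>p. \<iota> (prime_class H P \<phi> p)) (add_mset p M)) =
      \<iota> (mset_class {#p#}) \<otimes>\<^bsub>G\<^esub> \<iota> (mset_class M)"
      using add cl by (simp add: mset_class_single) (subst G.mset_prod_add_mset, auto)
    also have "\<dots> = \<iota> (mset_class {#p#} \<otimes>\<^bsub>Cl\<^esub> mset_class M)"
      using add.prems by (intro hom_mult[OF hom, symmetric] mset_class_closed) auto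
    also have "\<dots> = \<iota> (mset_class (add_mset p M))"
      using add.prems mset_class_add[of "{#p#}" M] by simp
    finally show ?case .
  qed
qed

lemma mset_prod_classes_eq_one_iff:
  assumes "comm_group G" "\<iota> \<in> iso Cl G" "set_mset M \<subseteq> P"
  shows "mset_prod G (image_mset (\<lambda>p. \<iota> (prime_class H P \<phi> p)) M) = \<one>\<^bsub>G\<^esub> \<longleftrightarrow> M \<in> im"
proof -
  interpret G: comm_group G by fact
  interpret Cl: comm_group Cl by (rule comm_group_Cl)
  have "\<iota> \<one>\<^bsub>Cl\<^esub> = \<one>\<^bsub>G\<^esub>" "inj_on \<iota> (carrier Cl)"
    using hom_one[OF _ Cl.is_group G.is_group] assms(2) by (auto simp: iso_def bij_betw_def)
  then have "\<iota> (mset_class M) = \<one>\<^bsub>G\<^esub> \<longleftrightarrow> mset_class M = \<one>\<^bsub>Cl\<^esub>"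
    using mset_class_closed[OF assms(3)] Cl.one_closed by (metis inj_onD)
  then show ?thesis using mset_prod_classes[OF assms] mset_class_eq_one_iff[OF assms(3)] by simp
qed

lemma prime_class_image_closed:
  assumes "\<iota> \<in> iso Cl G" "p \<in> P"
  shows "\<iota> (prime_class H P \<phi> p) \<in> carrier G"
  using assms mset_class_closed[of "{#p#}"] hom_in_carrier
  by (fastforce simp: mset_class_single iso_def)

end

section \<open>Zero-sum sequences\<close>

lemma carrier_zero_sum_monoid:
  "carrier (zero_sum_monoid G G0) = {S. set_mset S \<subseteq> G0 \<and> mset_prod G S = \<one>\<^bsub>G\<^esub>}"
  by (simp add: zero_sum_monoid_def)

lemma zero_sum_monoid_simps [simp]:
  "S \<otimes>\<^bsub>zero_sum_monoid G G0\<^esub> T = S + T"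
  "\<one>\<^bsub>zero_sum_monoid G G0\<^esub> = {#}"
  by (simp_all add: zero_sum_monoid_def)

lemma zero_sum_free_divisor_hom:
  assumes "comm_group G" "G0 \<subseteq> carrier G"
  shows "free_divisor_hom (zero_sum_monoid G G0) G0 (\<lambda>S. S)"
proof -
  interpret G: comm_group G by fact
  have add: "mset_prod G (S + T) = mset_prod G S \<otimes>\<^bsub>G\<^esub> mset_prod G T" if "set_mset S \<subseteq> G0" "set_mset T \<subseteq> G0" for S T
    using that assms(2) by (intro G.mset_prod_union) auto
  interpret comm_monoid_cancel "zero_sum_monoid G G0"
    by (rule comm_monoid_cancelI, unfold_locales) (auto simp: carrier_zero_sum_monoid add ac_simps)
  show ?thesis
  proof unfold_locales
    fix a b assume ab: "a \<in> carrier (zero_sum_monoid G G0)" "b \<in> carrier (zero_sum_monoid G G0)" "a \<subseteq># b"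
    then obtain d where d: "b = a + d" by (auto simp: subset_mset.le_iff_add)
    then have "mset_prod G d = \<one>\<^bsub>G\<^esub>"
      using ab add[of a d] G.mset_prod_closed[of d] assms(2) by (auto simp: carrier_zero_sum_monoid)
    then show "a divides\<^bsub>zero_sum_monoid G G0\<^esub> b"
      using ab d by (auto simp: factor_def carrier_zero_sum_monoid)
  qed (auto simp: carrier_zero_sum_monoid)
qed

text \<open>The only unit among the zero-sum sequences is the empty one, so units drop out.\<close>

lemma transfer_hom_zero_sum_iff:
  assumes G: "comm_group G" "G0 \<subseteq> carrier G"
  defines "B \<equiv> zero_sum_monoid G G0"
  shows "transfer_hom H B \<theta> \<longleftrightarrow>
    comm_monoid H \<and> atomic H \<and> unit_cancellative H \<and> \<theta> \<in> monoid_hom H B \<and>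
    \<theta> ` carrier H = carrier B \<and> {a \<in> carrier H. \<theta> a = {#}} = Units H \<and>
    (\<forall>u\<in>carrier H. \<forall>b\<in>carrier B. \<forall>c\<in>carrier B. \<theta> u = b + c \<longrightarrow>
      (\<exists>v\<in>carrier H. \<exists>w\<in>carrier H. u = v \<otimes>\<^bsub>H\<^esub> w \<and> \<theta> v = b \<and> \<theta> w = c))"
proof -
  interpret B: free_divisor_hom B G0 "\<lambda>S. S" unfolding B_def by (rule zero_sum_free_divisor_hom[OF G])
  have mult: "S \<otimes>\<^bsub>B\<^esub> T = S + T" "\<one>\<^bsub>B\<^esub> = {#}" for S T by (simp_all add: B_def)
  have units: "Units B = {{#}}" using B.Units_iff B.H.one_closed by (auto simp: mult)
  have inv: "inv\<^bsub>B\<^esub> {#} = {#}" using B.H.inv_one by (simp add: mult)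
  have "{\<epsilon> \<otimes>\<^bsub>B\<^esub> \<theta> a \<otimes>\<^bsub>B\<^esub> \<eta> | \<epsilon> a \<eta>. \<epsilon> \<in> Units B \<and> a \<in> carrier H \<and> \<eta> \<in> Units B} = \<theta> ` carrier H"
    by (auto simp: units mult)
  moreover have "\<theta> a \<in> Units B \<longleftrightarrow> \<theta> a = {#}" for a by (simp add: units)
  ultimately show ?thesis
    unfolding transfer_hom_def
    using B.H.comm_monoid_axioms B.atomic_H B.unit_cancellative_H
    by (auto simp: units inv mult)
qed

section \<open>Block homomorphisms are transfer homomorphisms\<close>

text \<open>
  What the class group contributes to the arithmetic: a multiset of primes lies in the image of
  \<open>S\<close> iff the sequence of its classes has sum zero. So the image is the preimage of the monoid of
  zero-sum sequences under the map that merges the primes of each class.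
\<close>

lemma block_homE:
  fixes G :: "'u monoid"
  assumes "block_hom S G G0 \<beta>"
  obtains P :: "'u set" and \<phi> c where "free_divisor_hom S P \<phi>" "G0 = c ` P" "G0 \<subseteq> carrier G" "comm_group G"
    "\<And>a. a \<in> carrier S \<Longrightarrow> \<beta> a = image_mset c (\<phi> a)"
    "\<And>M. set_mset M \<subseteq> P \<Longrightarrow> mset_prod G (image_mset c M) = \<one>\<^bsub>G\<^esub> \<longleftrightarrow> M \<in> \<phi> ` carrier S"
proof -
  obtain P :: "'u set" and \<phi> \<iota> where *: "divisor_hom S (free_monoid P) \<phi>" "\<iota> \<in> iso (class_group S P \<phi>) G"
    "G0 = (\<lambda>p. \<iota> (prime_class S P \<phi> p)) ` P" "comm_group G"
    "\<And>a. a \<in> carrier S \<Longrightarrow> \<beta> a = image_mset (\<lambda>p. \<iota> (prime_class S P \<phi> p)) (\<phi> a)"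
    using assms unfolding block_hom_def by blast
  interpret free_divisor_hom S P \<phi> using *(1) by (simp add: divisor_hom_free_iff)
  show ?thesis
  proof (rule that[of P \<phi> "\<lambda>p. \<iota> (prime_class S P \<phi> p)"])
    show "free_divisor_hom S P \<phi>" by (rule free_divisor_hom_axioms)
    show "G0 \<subseteq> carrier G" using *(3) prime_class_image_closed[OF *(2)] by auto
  qed (use * mset_prod_classes_eq_one_iff[OF *(4,2)] in simp_all)
qed

text \<open>
  The bounds for the catenary degree compose, because the constant two enters as a maximum and not as a
  sum; this makes the relation transitive.
\<close>

definition same_arithmetic :: "('a, 'm) monoid_scheme \<Rightarrow> ('b, 'n) monoid_scheme \<Rightarrow> bool" where
  "same_arithmetic H B \<longleftrightarrow> length_system H = length_system B \<and>
    catenary_degree B \<le> catenary_degree H \<and> catenary_degree H \<le> max (catenary_degree B) 2 \<and>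
    (locally_tame H \<longleftrightarrow> locally_tame B)"

lemma block_hom_transfer:
  fixes G :: "'u monoid"
  assumes block: "block_hom S G G0 \<beta>"
  shows "comm_group G" "G0 \<subseteq> carrier G" "transfer_hom S (zero_sum_monoid G G0) \<beta>"
    "same_arithmetic S (zero_sum_monoid G G0)"
proof -
  let ?B = "zero_sum_monoid G G0"
  obtain P :: "'u set" and \<phi> c where fd: "free_divisor_hom S P \<phi>" and G0: "G0 = c ` P" "G0 \<subseteq> carrier G" and G: "comm_group G"
    and \<beta>: "\<And>a. a \<in> carrier S \<Longrightarrow> \<beta> a = image_mset c (\<phi> a)"
    and sum: "\<And>M. set_mset M \<subseteq> P \<Longrightarrow> mset_prod G (image_mset c M) = \<one>\<^bsub>G\<^esub> \<longleftrightarrow> M \<in> \<phi> ` carrier S"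
    using block_homE[OF block] by metis
  show "comm_group G" "G0 \<subseteq> carrier G" by fact+
  interpret S: free_divisor_hom S P \<phi> by fact
  interpret B: free_divisor_hom ?B G0 "\<lambda>S. S" by (rule zero_sum_free_divisor_hom[OF G G0(2)])
  interpret mg: merged_primes "carrier ?B" c P
    using B.im.saturated_submonoid_axioms unfolding image_ident
    by (intro merged_primes.intro merged_primes_axioms.intro) (auto simp: G0(1) carrier_zero_sum_monoid)
  have B_im: "B.im = carrier ?B" by simp
  have pre: "mg.preimage = S.im"
  proof -
    have "M \<in> mg.preimage \<longleftrightarrow> M \<in> S.im" for M
      unfolding mg.preimage_iff using sum[of M] S.phi_closed by (auto simp: G0(1) carrier_zero_sum_monoid)
    then show ?thesis by blast
  qed
  have onto: "image_mset c ` S.im = carrier ?B"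
  proof -
    have "\<exists>M\<in>S.im. image_mset c M = T" if "T \<in> carrier ?B" for T using mg.lift_exists[OF that] pre by simp
    moreover have "image_mset c M \<in> carrier ?B" if "M \<in> S.im" for M using that pre mg.preimage_iff by metis
    ultimately show ?thesis by blast
  qed
  show "transfer_hom S ?B \<beta>"
    unfolding transfer_hom_zero_sum_iff[OF G G0(2)]
  proof (intro conjI ballI impI)
    have cl: "\<beta> a \<in> carrier ?B" if "a \<in> carrier S" for a
      using onto that \<beta> by (metis imageI)
    show "\<beta> \<in> monoid_hom S ?B"
      unfolding monoid_hom_def hom_def using cl \<beta> S.H.m_closed S.H.one_closed
      by auto
    show "\<beta> ` carrier S = carrier ?B"
      using onto \<beta> by (metis (no_types, lifting) image_cong image_image)
    show "{a \<in> carrier S. \<beta> a = {#}} = Units S"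
      using \<beta> by (auto simp: S.Units_iff)
    fix u b d assume u: "u \<in> carrier S" and bd: "b \<in> carrier ?B" "d \<in> carrier ?B" "\<beta> u = b + d"
    obtain m n where mn: "m \<in> S.im" "n \<in> S.im" "\<phi> u = m + n" "image_mset c m = b" "image_mset c n = d"
      using mg.lift_split[of "\<phi> u" b d] u bd \<beta> pre by (metis imageI)
    then obtain v where v: "v \<in> carrier S" "m = \<phi> v" by blast
    then obtain w where "w \<in> carrier S" "u = v \<otimes>\<^bsub>S\<^esub> w" "\<phi> u = \<phi> v + \<phi> w"
      using S.quotient_exists[of v u] mn u by auto
    then show "\<exists>v\<in>carrier S. \<exists>w\<in>carrier S. u = v \<otimes>\<^bsub>S\<^esub> w \<and> \<beta> v = b \<and> \<beta> w = d"
      using mn v \<beta> by (intro bexI[of _ v] bexI[of _ w]) auto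
  qed (use S.H.comm_monoid_axioms S.atomic_H S.unit_cancellative_H in auto)
  have "length_system S = length_system ?B"
  proof -
    have "length_system ?B = (\<lambda>T. size ` ms_factorizations (carrier ?B) T) ` image_mset c ` S.im"
      unfolding B.length_system_eq B_im onto ..
    also have "\<dots> = (\<lambda>s. size ` ms_factorizations S.im s) ` S.im"
      unfolding image_image[of _ "image_mset c"] by (rule image_cong[OF refl]) (use mg.lengths_eq pre in simp)
    finally show ?thesis unfolding S.length_system_eq ..
  qed
  moreover have "catenary_degree ?B \<le> catenary_degree S"
  proof -
    have "chained (ms_factorizations S.im s) (catenary_degree S)" if "s \<in> S.im" for s
      using S.catenary_degree_le_iff_im[of "catenary_degree S"] that by auto
    then have "chained (ms_factorizations (carrier ?B) T) (catenary_degree S)" if "T \<in> carrier ?B" for T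
      using that mg.chained_image_merged mg.lift_exists[OF that] unfolding pre by metis
    then show ?thesis unfolding B.catenary_degree_le_iff_im B_im by blast
  qed
  moreover have "catenary_degree S \<le> max (catenary_degree ?B) 2"
  proof -
    have "chained (ms_factorizations (carrier ?B) T) (catenary_degree ?B)" if "T \<in> carrier ?B" for T
      using B.catenary_degree_le_iff_im[of "catenary_degree ?B"] that unfolding B_im by auto
    then have "chained (ms_factorizations S.im s) (max (catenary_degree ?B) 2)" if "s \<in> S.im" for s
      using that mg.chained_lift_merged onto unfolding pre by blast
    then show ?thesis unfolding S.catenary_degree_le_iff_im by blast
  qed
  moreover have "locally_tame S \<longleftrightarrow> locally_tame ?B"
    using mg.locally_tame_iff_merged unfolding pre S.locally_tame_iff_im B.locally_tame_iff_im B_im .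
  ultimately show "same_arithmetic S ?B" unfolding same_arithmetic_def by blast
qed

text \<open>
  Zero-sum sequences have no units but the empty sequence, so liftings of decompositions can be composed directly.
\<close>

lemma block_hom_composition_transfer:
  fixes G :: "'u monoid"
  assumes "block_hom_composition H G G0 \<theta>"
  shows "comm_group G \<and> G0 \<subseteq> carrier G \<and> transfer_hom H (zero_sum_monoid G G0) \<theta> \<and>
    same_arithmetic H (zero_sum_monoid G G0)"
  using assms
proof induction
  case (single G G0 \<beta>)
  show ?case using block_hom_transfer[OF single] by blast
next
  case (comp G G0 \<theta> G' G0' \<beta>)
  note b = block_hom_transfer[OF comp.hyps(2)]
  let ?B = "zero_sum_monoid G G0" and ?C = "zero_sum_monoid G' G0'"
  have G: "comm_group G" "G0 \<subseteq> carrier G" using comp.IH by auto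
  have t: "transfer_hom H ?B \<theta>" using comp.IH by blast
  note t1 = t[unfolded transfer_hom_zero_sum_iff[OF G]]
  note t2 = b(3)[unfolded transfer_hom_zero_sum_iff[OF b(1,2)]]
  interpret B: free_divisor_hom ?B G0 "\<lambda>S. S" by (rule zero_sum_free_divisor_hom[OF G])
  have "transfer_hom H ?C (\<beta> \<circ> \<theta>)"
    unfolding transfer_hom_zero_sum_iff[OF b(1,2)]
  proof (intro conjI ballI impI)
    show "\<beta> \<circ> \<theta> \<in> monoid_hom H ?C"
      using t1 t2 unfolding monoid_hom_def by (auto simp: hom_def Pi_iff)
    show "(\<beta> \<circ> \<theta>) ` carrier H = carrier ?C"
      using t1 t2 by (metis image_comp)
    have "\<theta> a \<in> carrier ?B" if "a \<in> carrier H" for a using t1 that by blast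
    moreover have "Units ?B = {{#}}" using B.Units_iff B.H.one_closed by auto
    ultimately show "{a \<in> carrier H. (\<beta> \<circ> \<theta>) a = {#}} = Units H"
      using t1 t2 by auto
    fix u b d assume *: "u \<in> carrier H" "b \<in> carrier ?C" "d \<in> carrier ?C" "(\<beta> \<circ> \<theta>) u = b + d"
    then have "\<theta> u \<in> carrier ?B" using t1 by blast
    moreover have split: "\<forall>u\<in>carrier ?B. \<forall>b\<in>carrier ?C. \<forall>c\<in>carrier ?C. \<beta> u = b + c \<longrightarrow>
      (\<exists>v\<in>carrier ?B. \<exists>w\<in>carrier ?B. u = v + w \<and> \<beta> v = b \<and> \<beta> w = c)"
      using t2 by simp
    ultimately obtain v w where vw: "v \<in> carrier ?B" "w \<in> carrier ?B" "\<theta> u = v + w" "\<beta> v = b" "\<beta> w = d"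
      using * unfolding comp_apply by meson
    have "\<forall>u\<in>carrier H. \<forall>b\<in>carrier ?B. \<forall>c\<in>carrier ?B. \<theta> u = b + c \<longrightarrow>
      (\<exists>v\<in>carrier H. \<exists>w\<in>carrier H. u = v \<otimes>\<^bsub>H\<^esub> w \<and> \<theta> v = b \<and> \<theta> w = c)"
      using t1 by blast
    with vw *(1) obtain v' w' where "v' \<in> carrier H" "w' \<in> carrier H" "u = v' \<otimes>\<^bsub>H\<^esub> w'"
      "\<theta> v' = v" "\<theta> w' = w" by meson
    with vw show "\<exists>v\<in>carrier H. \<exists>w\<in>carrier H. u = v \<otimes>\<^bsub>H\<^esub> w \<and> (\<beta> \<circ> \<theta>) v = b \<and> (\<beta> \<circ> \<theta>) w = d"
      by auto
  qed (use t1 in blast)+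
  moreover have "same_arithmetic H ?C"
    using comp.IH b(4) unfolding same_arithmetic_def
    by (metis (no_types, opaque_lifting) max.assoc max.idem max.mono order_refl order_trans max.bounded_iff max.cobounded2)
  ultimately show ?case using b(1,2) by blast
qed


section \<open>Spanning elements and finitely generated class groups\<close>

text \<open>
  The inverse of every prime class is a sum of classes of primes dividing \<open>w\<close>. The formulation avoids
  the class group, so it carries over directly to renamed primes and to other divisor homomorphisms.
\<close>

definition spanning :: "('a, 'm) monoid_scheme \<Rightarrow> 'p set \<Rightarrow> ('a \<Rightarrow> 'p multiset) \<Rightarrow> 'a \<Rightarrow> bool" where
  "spanning H P \<phi> w \<longleftrightarrow> w \<in> carrier H \<and>
     (\<forall>p\<in>P. \<exists>a\<in>carrier H. p \<in># \<phi> a \<and> set_mset (\<phi> a - {#p#}) \<subseteq> set_mset (\<phi> w))"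

context free_divisor_hom begin

lemma cofinal_if_primes_divide:
  assumes "\<And>p. p \<in> P \<Longrightarrow> \<exists>a\<in>carrier H. p \<in># \<phi> a"
  shows "cofinal H (free_monoid P) \<phi>"
  unfolding cofinal_free_iff
proof (intro allI impI)
  fix M assume "set_mset M \<subseteq> P"
  then show "\<exists>u\<in>carrier H. set_mset (\<phi> u) \<subseteq> P \<and> M \<subseteq># \<phi> u"
  proof (induction M)
    case empty
    show ?case by (intro bexI[of _ \<one>]) auto
  next
    case (add p M)
    then obtain u where u: "u \<in> carrier H" "M \<subseteq># \<phi> u" by auto
    obtain a where a: "a \<in> carrier H" "p \<in># \<phi> a" using assms add.prems by auto
    note ua = u a
    then have "{#p#} + M \<subseteq># \<phi> a + \<phi> u" by (intro subset_mset.add_mono) auto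
    then show ?case using ua phi_closed[of "a \<otimes> u"] by (intro bexI[of _ "a \<otimes> u"]) auto
  qed
qed

lemma spanning_imp_cofinal: "spanning H P \<phi> w \<Longrightarrow> cofinal H (free_monoid P) \<phi>"
  unfolding spanning_def by (rule cofinal_if_primes_divide) blast

text \<open>
  Below a spanning element every class is the class of a multiset of primes dividing that element:
  the inverse of a prime class is such a class by definition, hence so is its own inverse.
\<close>

lemma spanning_classes:
  assumes span: "spanning H P \<phi> w" and X: "X \<in> carrier Cl"
  shows "\<exists>M. set_mset M \<subseteq> set_mset (\<phi> w) \<and> X = mset_class M"
proof -
  interpret Cl: comm_group Cl by (rule comm_group_Cl)
  let ?F = "set_mset (\<phi> w)"
  have F: "?F \<subseteq> P" using span phi_closed by (auto simp: spanning_def)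
  have neg_prime: "\<exists>K. set_mset K \<subseteq> ?F \<and> add_mset p K \<in> im" if p: "p \<in> P" for p
  proof -
    obtain a where "a \<in> carrier H" "p \<in># \<phi> a" "set_mset (\<phi> a - {#p#}) \<subseteq> ?F"
      using span p by (auto simp: spanning_def)
    then show ?thesis by (intro exI[of _ "\<phi> a - {#p#}"]) auto
  qed
  have neg: "\<exists>K'. set_mset K' \<subseteq> ?F \<and> K + K' \<in> im" if "set_mset K \<subseteq> ?F" for K
    using that
  proof (induction K)
    case empty
    show ?case using im.zero_mem by (intro exI[of _ "{#}"]) simp
  next
    case (add p K)
    then obtain K1 where "set_mset K1 \<subseteq> ?F" "K + K1 \<in> im" by fastforce
    moreover obtain K2 where "set_mset K2 \<subseteq> ?F" "add_mset p K2 \<in> im"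
      using neg_prime[of p] add.prems F by auto
    ultimately show ?case
      using im.add_mem[of "K + K1" "add_mset p K2"]
      by (intro exI[of _ "K1 + K2"]) (auto simp: ac_simps)
  qed
  have prime: "\<exists>M. set_mset M \<subseteq> ?F \<and> mset_class {#p#} = mset_class M" if p: "p \<in> P" for p
  proof -
    obtain K where K: "set_mset K \<subseteq> ?F" "add_mset p K \<in> im" using neg_prime[OF p] by blast
    obtain K' where K': "set_mset K' \<subseteq> ?F" "K + K' \<in> im" using neg[OF K(1)] by blast
    note K = K K'
    have "set_mset (add_mset p K) \<subseteq> P" "set_mset (K + K') \<subseteq> P" using K F p by auto
    then have one: "mset_class (add_mset p K) = \<one>\<^bsub>Cl\<^esub>" "mset_class (K + K') = \<one>\<^bsub>Cl\<^esub>"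
      using K by (simp_all only: mset_class_eq_one_iff)
    have "mset_class {#p#} = mset_class {#p#} \<otimes>\<^bsub>Cl\<^esub> mset_class (K + K')"
      using one p mset_class_closed[of "{#p#}"] by simp
    also have "\<dots> = mset_class (add_mset p K + K')"
      using mset_class_add[of "{#p#}" "K + K'"] p K(1,3) F by auto
    also have "\<dots> = mset_class K'"
      using mset_class_add[of "add_mset p K" K'] p K(1,3) F one mset_class_closed[of K'] by auto
    finally show ?thesis using K by blast
  qed
  obtain M where M: "set_mset M \<subseteq> P" "X = mset_class M"
    using mset_class_surj[OF spanning_imp_cofinal[OF span] X] by blast
  from M(1) have "\<exists>M'. set_mset M' \<subseteq> ?F \<and> mset_class M = mset_class M'"
  proof (induction M)
    case empty
    show ?case by (intro exI[of _ "{#}"]) simp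
  next
    case (add p M)
    then obtain M1 where M1: "set_mset M1 \<subseteq> ?F" "mset_class M = mset_class M1" by auto
    obtain M2 where "set_mset M2 \<subseteq> ?F" "mset_class {#p#} = mset_class M2"
      using prime[of p] add.prems by auto
    note M12 = M1 this
    have "mset_class (add_mset p M) = mset_class {#p#} \<otimes>\<^bsub>Cl\<^esub> mset_class M"
      using mset_class_add[of "{#p#}" M] add.prems by simp
    also have "\<dots> = mset_class (M2 + M1)"
      using mset_class_add[of M2 M1] M12 F by simp
    finally show ?case using M12 by (intro exI[of _ "M2 + M1"]) auto
  qed
  then show ?thesis using M by blast
qed

text \<open>
  The classes of multisets over the finitely many primes dividing \<open>w\<close> are all classes, and there are only countably many
  such multisets.
\<close>

lemma spanning_imp_fin_gen:
  assumes span: "spanning H P \<phi> w"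
  shows "fin_gen_group Cl" "countable (carrier Cl)"
proof -
  interpret Cl: comm_group Cl by (rule comm_group_Cl)
  let ?F = "set_mset (\<phi> w)"
  let ?A = "(\<lambda>p. mset_class {#p#}) ` ?F"
  have F: "?F \<subseteq> P" using span phi_closed by (auto simp: spanning_def)
  have A: "?A \<subseteq> carrier Cl" using F mset_class_closed by auto
  have "mset_class M \<in> generate Cl ?A" if "set_mset M \<subseteq> ?F" for M
    using that
  proof (induction M)
    case empty
    show ?case by (simp add: mset_class_empty generate.one)
  next
    case (add p M)
    then have "mset_class (add_mset p M) = mset_class {#p#} \<otimes>\<^bsub>Cl\<^esub> mset_class M"
      using mset_class_add[of "{#p#}" M] F by auto
    then show ?case using add by (auto intro: generate.eng generate.incl)
  qed
  then have "carrier Cl \<subseteq> generate Cl ?A" using spanning_classes[OF span] by blast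
  then have "generate Cl ?A = carrier Cl" using Cl.generate_incl[OF A] by blast
  then show "fin_gen_group Cl"
    unfolding fin_gen_group_def using A Cl.is_group by (intro conjI exI[of _ ?A]) auto
  have "{M. set_mset M \<subseteq> ?F} \<subseteq> mset ` lists ?F"
    by (auto simp: image_iff) (metis ex_mset in_listsI set_mset_mset subsetD)
  moreover have "countable (lists ?F)" by (intro countable_lists countable_finite) simp
  ultimately have "countable {M. set_mset M \<subseteq> ?F}" by (meson countable_image countable_subset)
  then have "countable (mset_class ` {M. set_mset M \<subseteq> ?F})" by simp
  moreover have "carrier Cl \<subseteq> mset_class ` {M. set_mset M \<subseteq> ?F}" using spanning_classes[OF span] by blast
  ultimately show "countable (carrier Cl)" by (rule countable_subset[rotated])
qed

text \<open>
  Generators and their inverses are classes of multisets; the finitely many primes occurring there generate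
  the class group as a monoid. For each of these primes, an element of \<open>H\<close> contains the prime and otherwise
  only primes of this finite set; the product of these elements is spanning.
\<close>

lemma fin_gen_imp_spanning:
  assumes cof: "cofinal H (free_monoid P) \<phi>" and fg: "fin_gen_group Cl"
  shows "\<exists>w. spanning H P \<phi> w"
proof -
  interpret Cl: comm_group Cl by (rule comm_group_Cl)
  obtain A where A: "finite A" "A \<subseteq> carrier Cl" "generate Cl A = carrier Cl"
    using fg by (auto simp: fin_gen_group_def)
  let ?A = "A \<union> (\<lambda>X. inv\<^bsub>Cl\<^esub> X) ` A"
  have "?A \<subseteq> carrier Cl" using A by auto
  then have "\<forall>X\<in>?A. \<exists>M. set_mset M \<subseteq> P \<and> X = mset_class M" using mset_class_surj[OF cof] by blast
  then obtain rep where rep: "\<And>X. X \<in> ?A \<Longrightarrow> set_mset (rep X) \<subseteq> P \<and> X = mset_class (rep X)" by metis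
  define F where "F = (\<Union>X\<in>?A. set_mset (rep X))"
  have F: "finite F" "F \<subseteq> P" using A(1) rep by (auto simp: F_def)
  have "\<exists>M. set_mset M \<subseteq> F \<and> X = mset_class M" if "X \<in> generate Cl A" for X
    using that
  proof induction
    case one
    then show ?case by (intro exI[of _ "{#}"]) (simp add: mset_class_empty)
  next
    case (incl X)
    then show ?case using rep[of X] by (intro exI[of _ "rep X"]) (auto simp: F_def)
  next
    case (inv X)
    then show ?case using rep[of "inv\<^bsub>Cl\<^esub> X"] by (intro exI[of _ "rep (inv\<^bsub>Cl\<^esub> X)"]) (auto simp: F_def)
  next
    case (eng X Y)
    then obtain M M' where "set_mset M \<subseteq> F" "X = mset_class M" "set_mset M' \<subseteq> F" "Y = mset_class M'" by blast
    then show ?case using F mset_class_add[of M M'] by (intro exI[of _ "M + M'"]) auto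
  qed
  then have classes: "\<exists>M. set_mset M \<subseteq> F \<and> X = mset_class M" if "X \<in> carrier Cl" for X using that A(3) by blast
  have neg: "\<exists>a\<in>carrier H. p \<in># \<phi> a \<and> set_mset (\<phi> a - {#p#}) \<subseteq> F" if p: "p \<in> P" for p
  proof -
    have X: "mset_class {#p#} \<in> carrier Cl" using p mset_class_closed by simp
    then obtain M where M: "set_mset M \<subseteq> F" "inv\<^bsub>Cl\<^esub> (mset_class {#p#}) = mset_class M"
      using classes Cl.inv_closed by blast
    have "mset_class (add_mset p M) = mset_class {#p#} \<otimes>\<^bsub>Cl\<^esub> mset_class M"
      using mset_class_add[of "{#p#}" M] M F p by auto
    also have "\<dots> = \<one>\<^bsub>Cl\<^esub>" using M(2)[symmetric] X by simp
    finally have "add_mset p M \<in> im" using M(1) F(2) p by (subst (asm) mset_class_eq_one_iff) auto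
    then obtain a where "a \<in> carrier H" "add_mset p M = \<phi> a" by blast
    then show ?thesis using M(1) by (intro bexI[of _ a]) (auto simp flip: \<open>add_mset p M = \<phi> a\<close>)
  qed
  have "\<exists>w\<in>carrier H. F' \<subseteq> set_mset (\<phi> w) \<and> set_mset (\<phi> w) \<subseteq> F" if "finite F'" "F' \<subseteq> F" for F'
    using that
  proof (induction rule: finite_induct)
    case empty
    show ?case by (intro bexI[of _ \<one>]) auto
  next
    case (insert f F')
    then obtain w where w: "w \<in> carrier H" "F' \<subseteq> set_mset (\<phi> w)" "set_mset (\<phi> w) \<subseteq> F" by auto
    obtain a where a: "a \<in> carrier H" "f \<in># \<phi> a" "set_mset (\<phi> a - {#f#}) \<subseteq> F"
      using neg insert.prems F by blast
    have "set_mset (\<phi> a) \<subseteq> F" using a insert.prems by (metis insert_DiffM insert_subset set_mset_add_mset_insert)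
    then show ?case using a w by (intro bexI[of _ "w \<otimes> a"]) auto
  qed
  from this[OF F(1) order_refl] obtain w where "w \<in> carrier H" "set_mset (\<phi> w) = F" by blast
  then have "spanning H P \<phi> w" using neg by (auto simp: spanning_def)
  then show ?thesis by blast
qed

text \<open>
  A finitely generated class group is countable, so that it has an isomorphic copy on any infinite type.
\<close>

lemma class_group_copy_exists:
  assumes span: "spanning H P \<phi> w" and inf: "infinite (UNIV :: 'u set)"
  shows "\<exists>(G :: 'u monoid) \<iota>. comm_group G \<and> fin_gen_group G \<and> \<iota> \<in> iso Cl G"
proof -
  interpret Cl: comm_group Cl by (rule comm_group_Cl)
  obtain f :: "nat \<Rightarrow> 'u" where f: "inj f" using inf infinite_countable_subset by blast
  define h where "h = f \<circ> to_nat_on (carrier Cl)"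
  have "inj_on h (carrier Cl)"
    unfolding h_def using f inj_on_to_nat_on[OF spanning_imp_fin_gen(2)[OF span]]
    by (intro comp_inj_on) (auto intro: inj_on_subset)
  note inj = this
  define G where "G = \<lparr>carrier = h ` carrier Cl,
    mult = (\<lambda>x y. h (inv_into (carrier Cl) h x \<otimes>\<^bsub>Cl\<^esub> inv_into (carrier Cl) h y)), one = h \<one>\<^bsub>Cl\<^esub>\<rparr>"
  have iso: "h \<in> iso Cl G"
    using inj by (auto simp: iso_def hom_def bij_betw_def G_def)
  have one: "G \<lparr>one := h \<one>\<^bsub>Cl\<^esub>\<rparr> = G" by (simp add: G_def)
  have G: "comm_group G"
    using Cl.iso_imp_img_comm_group[OF iso] one by simp
  interpret G: comm_group G by (rule G)
  interpret hom: group_hom Cl G h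
    using iso by unfold_locales (simp add: iso_def)
  obtain A where A: "finite A" "A \<subseteq> carrier Cl" "generate Cl A = carrier Cl"
    using spanning_imp_fin_gen(1)[OF span] by (auto simp: fin_gen_group_def)
  have "generate G (h ` A) = carrier G"
    using hom.generate_img[OF A(2)] A(3) iso by (simp add: iso_def bij_betw_def)
  moreover have "h ` A \<subseteq> carrier G" using A(2) hom.hom_closed by blast
  ultimately have "fin_gen_group G"
    unfolding fin_gen_group_def using A(1) G.is_group by blast
  with G iso show ?thesis by blast
qed

end

text \<open>
  The block homomorphism maps spanning elements to spanning elements: merging primes preserves the witnesses.
\<close>

lemma spanning_block_hom_exists:
  fixes P :: "'u set"
  assumes krull: "krull_monoid H" and fd: "free_divisor_hom H P \<phi>" and span: "spanning H P \<phi> w"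
    and inf: "infinite (UNIV :: 'u set)"
  shows "\<exists>(G :: 'u monoid) c. block_hom H G (c ` P) (\<lambda>a. image_mset c (\<phi> a)) \<and> fin_gen_group G \<and>
    spanning (zero_sum_monoid G (c ` P)) (c ` P) (\<lambda>S. S) (image_mset c (\<phi> w))"
proof -
  interpret free_divisor_hom H P \<phi> by fact
  obtain G :: "'u monoid" and \<iota> where G: "comm_group G" "fin_gen_group G" "\<iota> \<in> iso Cl G"
    using class_group_copy_exists[OF span inf] by blast
  define c where "c = (\<lambda>p. \<iota> (prime_class H P \<phi> p))"
  have block: "block_hom H G (c ` P) (\<lambda>a. image_mset c (\<phi> a))"
    unfolding block_hom_def using krull G fd spanning_imp_cofinal[OF span] divisor_hom_free_iff[of H P \<phi>]
    by (auto intro!: exI[of _ P] exI[of _ \<phi>] exI[of _ \<iota>] simp: c_def)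
  let ?Z = "zero_sum_monoid G (c ` P)"
  have mem: "image_mset c (\<phi> a) \<in> carrier ?Z" if "a \<in> carrier H" for a
    using that phi_closed[of a] mset_prod_classes_eq_one_iff[OF G(1,3), of "\<phi> a"]
    by (auto simp: carrier_zero_sum_monoid c_def)
  have "spanning ?Z (c ` P) (\<lambda>S. S) (image_mset c (\<phi> w))"
    unfolding spanning_def
  proof (intro conjI ballI)
    show "image_mset c (\<phi> w) \<in> carrier ?Z" using mem span by (simp add: spanning_def)
    fix g assume "g \<in> c ` P"
    then obtain p where p: "p \<in> P" "g = c p" by blast
    then obtain a where a: "a \<in> carrier H" "p \<in># \<phi> a" "set_mset (\<phi> a - {#p#}) \<subseteq> set_mset (\<phi> w)"
      using span by (auto simp: spanning_def)
    have "image_mset c (\<phi> a) - {#g#} = image_mset c (\<phi> a - {#p#})"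
      using a p by (simp add: image_mset_Diff)
    then show "\<exists>T\<in>carrier ?Z. g \<in># T \<and> set_mset (T - {#g#}) \<subseteq> set_mset (image_mset c (\<phi> w))"
      using a p mem[OF a(1)] by (intro bexI[of _ "image_mset c (\<phi> a)"]) auto
  qed
  with block G show ?thesis by blast
qed

section \<open>The divisor theory of a saturated submonoid\<close>

locale spanned_submonoid = saturated_submonoid B
  for B :: "'p multiset set" and P :: "'p set" and w :: "'p multiset" +
  assumes B_primes: "M \<in> B \<Longrightarrow> set_mset M \<subseteq> P"
    and w_mem: "w \<in> B"
    and span: "p \<in> P \<Longrightarrow> \<exists>M\<in>B. p \<in># M \<and> set_mset (M - {#p#}) \<subseteq> set_mset w"
begin

text \<open>
  A set of primes is redundant if divisibility in \<open>B\<close> can be tested on the other primes. The search for a maximal redundant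
  set is confined to the finitely many primes of \<open>w\<close>.
\<close>

definition redundant :: "'p set \<Rightarrow> bool" where
  "redundant R \<longleftrightarrow> (\<forall>M\<in>B. \<forall>N\<in>B. (\<forall>q\<in>P - R. count M q \<le> count N q) \<longrightarrow> M \<subseteq># N)"

lemma redundant_empty: "redundant {}"
  unfolding redundant_def
proof (intro ballI impI)
  fix M N assume M: "M \<in> B" and le: "\<forall>q\<in>P - {}. count M q \<le> count N q"
  have "count M q \<le> count N q" for q
    using le B_primes[OF M] by (cases "q \<in># M") (auto simp: not_in_iff)
  then show "M \<subseteq># N" by (simp add: subseteq_mset_def)
qed

lemma maximal_redundant_exists:
  "\<exists>R\<subseteq>set_mset w. redundant R \<and> (\<forall>h\<in>set_mset w - R. \<not> redundant (insert h R))"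
proof -
  let ?S = "{R. R \<subseteq> set_mset w \<and> redundant R}"
  have "finite ?S" by (rule finite_subset[of _ "Pow (set_mset w)"]) auto
  moreover have "{} \<in> ?S" by (simp add: redundant_empty)
  ultimately obtain R where R: "R \<in> ?S" "\<forall>R'\<in>?S. R \<subseteq> R' \<longrightarrow> R = R'"
    using finite_has_maximal2[of ?S "{}"] by blast
  have "\<not> redundant (insert h R)" if "h \<in> set_mset w - R" for h
    using R that by blast
  with R show ?thesis by blast
qed

end

locale minimal_primes = spanned_submonoid +
  fixes R
  assumes R_subset: "R \<subseteq> set_mset w"
    and R_redundant: "redundant R"
    and R_maximal: "h \<in> set_mset w - R \<Longrightarrow> \<not> redundant (insert h R)"
begin

definition Q where "Q = P - R"

text \<open>
  The generator of the group of valuations at \<open>q\<close> (see \<open>index_dvd\<close>), defined as the least positive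
  valuation so that it is attained by an element of \<open>B\<close>.
\<close>

definition index where "index q = (LEAST n. n > 0 \<and> (\<exists>M\<in>B. count M q = n))"

definition \<psi> where
  "\<psi> M = (\<Sum>q\<in>set_mset M \<inter> Q. replicate_mset (count M q div index q) q)"

lemma le_if_le_on_Q: "\<lbrakk>M \<in> B; N \<in> B; \<And>q. q \<in> Q \<Longrightarrow> count M q \<le> count N q\<rbrakk> \<Longrightarrow> M \<subseteq># N"
  using R_redundant by (auto simp: redundant_def Q_def)

text \<open>
  If \<open>h\<close> is essential, some quotient of elements of \<open>B\<close> is negative at \<open>h\<close> and nowhere else in \<open>Q\<close>.
\<close>

lemma negative_quotient:
  assumes "h \<in> Q" "h \<in># w"
  obtains M N where "M \<in> B" "N \<in> B" "count N h < count M h" "\<And>q. q \<in> Q \<Longrightarrow> q \<noteq> h \<Longrightarrow> count M q \<le> count N q"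
proof -
  have "\<not> redundant (insert h R)" using assms R_maximal by (auto simp: Q_def)
  then obtain M N where MN: "M \<in> B" "N \<in> B" "\<forall>q\<in>P - insert h R. count M q \<le> count N q" "\<not> M \<subseteq># N"
    by (auto simp: redundant_def)
  have le: "count M q \<le> count N q" if "q \<in> Q" "q \<noteq> h" for q
    using MN(3) that by (auto simp: Q_def)
  have "count N h < count M h"
    using le_if_le_on_Q[OF MN(1,2)] le MN(4) by (metis not_less)
  then show ?thesis using that MN le by blast
qed

lemma index_props:
  assumes "q \<in> Q"
  shows "index q > 0" "\<exists>M\<in>B. count M q = index q" "\<And>M. M \<in> B \<Longrightarrow> 0 < count M q \<Longrightarrow> index q \<le> count M q"
proof -
  obtain M where "M \<in> B" "q \<in># M" using span[of q] assms by (auto simp: Q_def)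
  then have "\<exists>n. n > 0 \<and> (\<exists>M\<in>B. count M q = n)" by (intro exI[of _ "count M q"]) auto
  from LeastI_ex[OF this] show "index q > 0" "\<exists>M\<in>B. count M q = index q"
    unfolding index_def by blast+
  show "index q \<le> count M q" if "M \<in> B" "0 < count M q" for M
    unfolding index_def using that by (intro Least_le) blast
qed

lemma index_outside: "q \<in> Q \<Longrightarrow> q \<notin># w \<Longrightarrow> index q = 1"
proof -
  assume q: "q \<in> Q" "q \<notin># w"
  then obtain M where M: "M \<in> B" "q \<in># M" "set_mset (M - {#q#}) \<subseteq> set_mset w"
    using span[of q] by (auto simp: Q_def)
  then have "q \<notin># M - {#q#}" using q by blast
  then have "count M q = 1" using M(2) by (simp add: not_in_iff) (metis One_nat_def Suc_pred count_greater_zero_iff diff_is_0_eq)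
  then show ?thesis using index_props[OF q(1)] M(1) by (metis One_nat_def Suc_leI le_antisym zero_less_one)
qed

text \<open>
  A valuation that is not a multiple could be reduced modulo the index, contradicting minimality: the
  negative valuations that arise are repaired with a quotient that is negative at \<open>q\<close> only.
\<close>

lemma index_dvd:
  assumes K: "K \<in> B" and q: "q \<in> Q"
  shows "index q dvd count K q"
proof (cases "q \<in># w")
  case False
  then show ?thesis using index_outside[OF q] by simp
next
  case True
  obtain M N where MN: "M \<in> B" "N \<in> B" "count N q < count M q" "\<And>r. r \<in> Q \<Longrightarrow> r \<noteq> q \<Longrightarrow> count M r \<le> count N r"
    using negative_quotient[OF q True] by blast
  obtain A where A: "A \<in> B" "count A q = index q" using index_props[OF q] by blast
  let ?e = "index q"
  define t where "t = count K q div ?e"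
  define r where "r = count K q mod ?e"
  define n where "n = count M q - count N q"
  \<comment> \<open>As a quotient, \<open>?X / ?Y\<close> is \<open>K / A^t\<close> times \<open>A^(t n) (N / M)^(t e)\<close>. The second factor has
    valuation zero at \<open>q\<close> and makes up for the negative valuations of the first one elsewhere.\<close>
  let ?X = "K + repeat_mset (t * (n - 1)) A + repeat_mset (t * ?e) N"
  let ?Y = "repeat_mset (t * ?e) M"
  have K': "count K q = t * ?e + r" by (simp only: t_def r_def div_mult_mod_eq)
  have n: "n > 0" "count M q = count N q + n" using MN(3) by (auto simp: n_def)
  have "t * ?e + t * (n - 1) * ?e = t * ?e * n"
    using n(1) by (cases n) (simp_all add: algebra_simps)
  then have XY: "count ?X q = count ?Y q + r"
    using K' A n(2) by (simp add: algebra_simps)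
  have mem: "?X \<in> B" "?Y \<in> B" using K A MN by (auto intro!: add_mem repeat_mem)
  have "?Y \<subseteq># ?X"
  proof (rule le_if_le_on_Q[OF mem(2,1)])
    fix s assume s: "s \<in> Q"
    show "count ?Y s \<le> count ?X s"
    proof (cases "s = q")
      case True
      then show ?thesis using XY by simp
    next
      case False
      then have "t * ?e * count M s \<le> t * ?e * count N s" using MN(4) s by simp
      then show ?thesis unfolding count_union count_repeat_mset by linarith
    qed
  qed
  then have "?X - ?Y \<in> B" using diff_mem mem by blast
  moreover have "count (?X - ?Y) q = r" using XY by simp
  moreover have "r < ?e" using index_props[OF q] by (simp add: r_def)
  ultimately have "r = 0" using index_props(3)[OF q] by (metis gr0I not_le)
  then show ?thesis using K' by simp
qed

lemma count_psi: "count (\<psi> M) q = (if q \<in> Q then count M q div index q else 0)"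
proof -
  have "count (\<psi> M) q = (\<Sum>r\<in>set_mset M \<inter> Q. if q = r then count M r div index r else 0)"
    unfolding \<psi>_def by (simp add: count_sum)
  also have "\<dots> = (if q \<in> set_mset M \<inter> Q then count M q div index q else 0)"
    by (rule sum.delta') simp
  finally show ?thesis by (auto simp: not_in_iff)
qed

lemma psi_subset: "\<psi> M \<subseteq># M"
  by (simp add: subseteq_mset_def count_psi)

lemma set_psi: "set_mset (\<psi> M) \<subseteq> Q"
  by (auto simp: count_psi simp flip: count_greater_zero_iff split: if_splits)

lemma psi_add: "M \<in> B \<Longrightarrow> N \<in> B \<Longrightarrow> \<psi> (M + N) = \<psi> M + \<psi> N"
  by (auto simp: multiset_eq_iff count_psi index_dvd div_plus_div_distrib_dvd_left)

lemma psi_empty: "\<psi> {#} = {#}"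
  by (simp add: \<psi>_def)

lemma in_psi_iff: "M \<in> B \<Longrightarrow> q \<in># \<psi> M \<longleftrightarrow> q \<in> Q \<and> q \<in># M"
proof -
  assume M: "M \<in> B"
  have "count M q div index q > 0 \<longleftrightarrow> count M q > 0" if "q \<in> Q"
    using index_dvd[OF M that] index_props(1)[OF that]
    by (metis div_greater_zero_iff div_0 dvd_imp_le gr0I)
  then show ?thesis by (auto simp: count_psi simp flip: count_greater_zero_iff split: if_splits)
qed

lemma psi_reflects_le: "M \<in> B \<Longrightarrow> N \<in> B \<Longrightarrow> \<psi> M \<subseteq># \<psi> N \<Longrightarrow> M \<subseteq># N"
proof (rule le_if_le_on_Q)
  fix q assume MN: "M \<in> B" "N \<in> B" "\<psi> M \<subseteq># \<psi> N" and q: "q \<in> Q"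
  then have "count M q div index q \<le> count N q div index q"
    using q count_psi[of M q] count_psi[of N q] by (metis mset_subset_eq_count)
  then have "count M q div index q * index q \<le> count N q div index q * index q" by simp
  then show "count M q \<le> count N q" using index_dvd[OF MN(1) q] index_dvd[OF MN(2) q] by simp
qed

text \<open>
  If \<open>h\<close> divides \<open>w\<close>, start from any element divisible by \<open>q\<close> and cancel its valuation at \<open>h\<close> with a
  quotient that is negative at \<open>h\<close> only. Otherwise \<open>w\<close> itself or a witness for \<open>q\<close> avoids \<open>h\<close>.
\<close>

lemma separate_primes:
  assumes q: "q \<in> Q" and h: "h \<in> Q" "h \<noteq> q"
  shows "\<exists>K\<in>B. q \<in># K \<and> h \<notin># K"
proof (cases "h \<in># w")
  case False
  show ?thesis
  proof (cases "q \<in># w")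
    case True
    then show ?thesis using False w_mem by blast
  next
    case notin: False
    obtain M where M: "M \<in> B" "q \<in># M" "set_mset (M - {#q#}) \<subseteq> set_mset w"
      using span[of q] q by (auto simp: Q_def)
    then have "h \<notin># M - {#q#}" using False by blast
    then show ?thesis using M h(2) by (intro bexI[of _ M]) (auto simp: in_diff_count not_in_iff)
  qed
next
  case True
  obtain M N where MN: "M \<in> B" "N \<in> B" "count N h < count M h" "\<And>r. r \<in> Q \<Longrightarrow> r \<noteq> h \<Longrightarrow> count M r \<le> count N r"
    using negative_quotient[OF h(1) True] by blast
  obtain K where K: "K \<in> B" "q \<in># K" using span[of q] q by (auto simp: Q_def)
  define k where "k = count K h"
  define n where "n = count M h - count N h"
  have n: "n > 0" "count M h = count N h + n" using MN(3) by (auto simp: n_def)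
  let ?X = "repeat_mset n K + repeat_mset k N"
  let ?Y = "repeat_mset k M"
  have XY: "count ?X h = count ?Y h" using n by (simp add: k_def algebra_simps)
  have mem: "?X \<in> B" "?Y \<in> B" using K MN by (auto intro!: add_mem repeat_mem)
  have le: "k * count M s \<le> k * count N s" if "s \<in> Q" "s \<noteq> h" for s using MN(4) that by simp
  have "?Y \<subseteq># ?X"
  proof (rule le_if_le_on_Q[OF mem(2,1)])
    fix s assume s: "s \<in> Q"
    show "count ?Y s \<le> count ?X s"
    proof (cases "s = h")
      case True
      then show ?thesis using XY by simp
    next
      case False
      then show ?thesis
        using le[OF s False] unfolding count_union count_repeat_mset by linarith
    qed
  qed
  then have "?X - ?Y \<in> B" using diff_mem mem by blast
  moreover have "h \<notin># ?X - ?Y" using XY by (simp add: in_diff_count)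
  moreover have "n * count K q > 0" using n(1) K(2) by simp
  then have "count ?Y q < count ?X q"
    using le[OF q h(2)[symmetric]] unfolding count_union count_repeat_mset by linarith
  then have "q \<in># ?X - ?Y" by (simp only: in_diff_count)
  ultimately show ?thesis by blast
qed

text \<open>
  An element with the least positive valuation at \<open>q\<close> has value one at \<open>q\<close> under \<open>\<psi>\<close>. It has only finitely
  many other primes, and \<open>separate_primes\<close> gives for each of them a multiple of \<open>q\<close> that excludes it.
\<close>

lemma prime_is_gcd:
  assumes q: "q \<in> Q"
  shows "\<exists>X. finite X \<and> X \<noteq> {} \<and> X \<subseteq> B \<and> (\<forall>x\<in>X. q \<in># \<psi> x) \<and>
    (\<forall>d. (\<forall>x\<in>X. d \<subseteq># \<psi> x) \<longrightarrow> d \<subseteq># {#q#})"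
proof -
  obtain K0 where K0: "K0 \<in> B" "count K0 q = index q" using index_props[OF q] by blast
  obtain K where K: "\<And>h. h \<in> Q \<Longrightarrow> h \<noteq> q \<Longrightarrow> K h \<in> B \<and> q \<in># K h \<and> h \<notin># K h"
    using separate_primes[OF q] by metis
  let ?X = "insert K0 (K ` (set_mset K0 \<inter> Q - {q}))"
  have c0: "count (\<psi> K0) q = 1" using K0 q index_props(1)[OF q] by (simp add: count_psi)
  have "d \<subseteq># {#q#}" if d: "\<forall>x\<in>?X. d \<subseteq># \<psi> x" for d
    unfolding subseteq_mset_def
  proof
    fix h
    have d0: "count d h \<le> count (\<psi> K0) h" using d by (simp add: mset_subset_eq_count)
    consider "h = q" | "h \<noteq> q" "h \<in> set_mset K0 \<inter> Q" | "h \<noteq> q" "h \<notin> set_mset K0 \<inter> Q" by blast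
    then show "count d h \<le> count {#q#} h"
    proof cases
      case 1
      then show ?thesis using d0 c0 by simp
    next
      case 2
      then have "count d h \<le> count (\<psi> (K h)) h" using d by (auto simp: mset_subset_eq_count)
      then show ?thesis using K[of h] 2 by (simp add: count_psi not_in_iff)
    next
      case 3
      then show ?thesis using d0 by (auto simp: count_psi not_in_iff split: if_splits)
    qed
  qed
  moreover have "\<forall>x\<in>?X. q \<in># \<psi> x"
    using c0 K q by (auto simp: in_psi_iff K0 simp flip: count_greater_zero_iff[of "\<psi> K0"])
  moreover have "?X \<subseteq> B" using K0 K by auto
  ultimately show ?thesis by (intro exI[of _ ?X]) auto
qed

lemma psi_spanning: "q \<in> Q \<Longrightarrow> \<exists>M\<in>B. q \<in># \<psi> M \<and> set_mset (\<psi> M - {#q#}) \<subseteq> set_mset (\<psi> w)"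
proof (cases "q \<in># w")
  case True
  moreover assume "q \<in> Q"
  ultimately show ?thesis using w_mem in_psi_iff by (intro bexI[of _ w]) (auto dest: in_diffD)
next
  case False
  assume q: "q \<in> Q"
  then obtain M where M: "M \<in> B" "q \<in># M" "set_mset (M - {#q#}) \<subseteq> set_mset w"
    using span[of q] by (auto simp: Q_def)
  have "s \<in># \<psi> w" if s: "s \<in># \<psi> M - {#q#}" for s
  proof -
    have "\<psi> M - {#q#} \<subseteq># M - {#q#}"
      using psi_subset[of M] by (auto simp: subseteq_mset_def intro: diff_le_mono)
    then have "s \<in># w" using s M(3) by (meson mset_subset_eqD subsetD)
    moreover have "s \<in> Q" using s set_psi in_diffD by (metis subsetD)
    ultimately show ?thesis using in_psi_iff w_mem by blast
  qed
  then show ?thesis using M q in_psi_iff by (intro bexI[of _ M]) auto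
qed

text \<open>
  As \<open>\<psi> w\<close> is contained in \<open>w\<close>, equal size forces equality, so no prime of \<open>w\<close> was discarded or
  has index above one. Primes outside \<open>w\<close> are never discarded and have index one anyway.
\<close>

lemma psi_trivial:
  assumes "size (\<psi> w) = size w"
  shows "Q = P" "M \<in> B \<Longrightarrow> \<psi> M = M"
proof -
  have w: "\<psi> w = w"
    using assms psi_subset[of w] by (metis mset_subset_size nat_neq_iff subset_mset.le_less)
  then have wQ: "set_mset w \<subseteq> Q" using set_psi[of w] by simp
  then show Q: "Q = P" using R_subset by (auto simp: Q_def)
  have "index q = 1" if q: "q \<in> Q" for q
  proof (cases "q \<in># w")
    case True
    then have "count w q div index q = count w q" "count w q > 0"
      using w count_psi[of w q] q by auto
    then show ?thesis by (metis div_eq_dividend_iff)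
  qed (simp add: index_outside q)
  then show "\<psi> M = M" if "M \<in> B"
    using B_primes[OF that] Q by (auto simp: multiset_eq_iff count_psi) (metis count_eq_zero_iff subsetD)
qed

end

section \<open>Divisor theories\<close>

text \<open>
  All divisors of a multiset over \<open>P\<close> are multisets over \<open>P\<close>, so the greatest common divisor may be taken among all
  multisets.
\<close>

lemma divisor_theory_iff:
  "divisor_theory H P \<phi> \<longleftrightarrow> free_divisor_hom H P \<phi> \<and>
    (\<forall>p\<in>P. \<exists>X. finite X \<and> X \<noteq> {} \<and> X \<subseteq> carrier H \<and> (\<forall>x\<in>X. p \<in># \<phi> x) \<and>
      (\<forall>d. (\<forall>x\<in>X. d \<subseteq># \<phi> x) \<longrightarrow> d \<subseteq># {#p#}))"
proof -
  have "is_gcd_of_set (free_monoid P) {#p#} (\<phi> ` X) \<longleftrightarrow> (\<forall>x\<in>X. p \<in># \<phi> x) \<and>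
      (\<forall>d. (\<forall>x\<in>X. d \<subseteq># \<phi> x) \<longrightarrow> d \<subseteq># {#p#})"
    if fd: "free_divisor_hom H P \<phi>" and X: "X \<subseteq> carrier H" "X \<noteq> {}" and p: "p \<in> P" for X p
  proof -
    interpret free_divisor_hom H P \<phi> by fact
    have cl: "set_mset (\<phi> x) \<subseteq> P" if "x \<in> X" for x using phi_closed X that by blast
    have "set_mset d \<subseteq> P" if "\<forall>x\<in>X. d \<subseteq># \<phi> x" for d
      using that X(2) cl by (meson all_not_in_conv set_mset_mono subset_trans)
    then show ?thesis
      using p cl by (auto simp: is_gcd_of_set_def divides_free_monoid_iff)
  qed
  then show ?thesis
    unfolding divisor_theory_def divisor_hom_free_iff by (intro conj_cong ball_cong ex_cong1 refl) auto
qed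

lemma image_mset_subset_iff:
  assumes "inj_on j P" "set_mset M \<subseteq> P" "set_mset N \<subseteq> P"
  shows "image_mset j M \<subseteq># image_mset j N \<longleftrightarrow> M \<subseteq># N"
proof
  have inv: "image_mset (inv_into P j) (image_mset j K) = K" if "set_mset K \<subseteq> P" for K
  proof -
    have "image_mset (inv_into P j \<circ> j) K = image_mset id K"
      using that assms(1) by (intro image_mset_cong) (auto simp: inv_into_f_f subset_iff)
    then show ?thesis by (simp add: image_mset.compositionality)
  qed
  assume "image_mset j M \<subseteq># image_mset j N"
  then show "M \<subseteq># N" using inv[OF assms(2)] inv[OF assms(3)] by (metis image_mset_subseteq_mono)
qed (rule image_mset_subseteq_mono)

lemma rename_free_divisor_hom:
  assumes "free_divisor_hom H P \<phi>" "inj_on j P"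
  shows "free_divisor_hom H (j ` P) (\<lambda>a. image_mset j (\<phi> a))"
proof -
  interpret free_divisor_hom H P \<phi> by fact
  show ?thesis
  proof unfold_locales
    fix a b assume "a \<in> carrier H" "b \<in> carrier H" "image_mset j (\<phi> a) \<subseteq># image_mset j (\<phi> b)"
    then show "a divides\<^bsub>H\<^esub> b"
      using image_mset_subset_iff[OF assms(2)] phi_closed reflects_divides by blast
  qed (use phi_closed in auto)
qed

lemma rename_divisor_theory:
  assumes dt: "divisor_theory H P \<phi>" and j: "inj_on j P"
  shows "divisor_theory H (j ` P) (\<lambda>a. image_mset j (\<phi> a))"
  unfolding divisor_theory_iff
proof (intro conjI ballI)
  have fd: "free_divisor_hom H P \<phi>" using dt by (simp add: divisor_theory_iff)
  interpret free_divisor_hom H P \<phi> by fact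
  show "free_divisor_hom H (j ` P) (\<lambda>a. image_mset j (\<phi> a))" by (rule rename_free_divisor_hom[OF fd j])
  fix q assume "q \<in> j ` P"
  then obtain p where p: "p \<in> P" "q = j p" by blast
  then obtain X where X: "finite X" "X \<noteq> {}" "X \<subseteq> carrier H" "\<forall>x\<in>X. p \<in># \<phi> x"
    "\<And>d. (\<forall>x\<in>X. d \<subseteq># \<phi> x) \<Longrightarrow> d \<subseteq># {#p#}"
    using dt unfolding divisor_theory_iff by meson
  have "d \<subseteq># {#q#}" if d: "\<forall>x\<in>X. d \<subseteq># image_mset j (\<phi> x)" for d
  proof -
    obtain x0 where x0: "x0 \<in> X" using X(2) by blast
    then obtain e where e: "image_mset j (\<phi> x0) = d + e" using d by (metis subset_mset.le_iff_add)
    then obtain d' e' where d': "\<phi> x0 = d' + e'" "image_mset j d' = d" by (metis image_mset_eq_plusD)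
    have sub: "set_mset d' \<subseteq> P" using phi_closed[of x0] x0 X(3) d'(1) by auto
    have "d' \<subseteq># \<phi> x" if "x \<in> X" for x
      using d that d'(2) image_mset_subset_iff[OF j sub] phi_closed X(3) by blast
    then have "d' \<subseteq># {#p#}" using X(5) by blast
    then show ?thesis using d'(2) p(2) image_mset_subseteq_mono by fastforce
  qed
  then show "\<exists>X. finite X \<and> X \<noteq> {} \<and> X \<subseteq> carrier H \<and> (\<forall>x\<in>X. q \<in># image_mset j (\<phi> x)) \<and>
      (\<forall>d. (\<forall>x\<in>X. d \<subseteq># image_mset j (\<phi> x)) \<longrightarrow> d \<subseteq># {#q#})"
    using X p by (intro exI[of _ X]) auto
qed

lemma rename_spanning:
  assumes "spanning H P \<phi> w"
  shows "spanning H (j ` P) (\<lambda>a. image_mset j (\<phi> a)) w"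
  unfolding spanning_def
proof (intro conjI ballI)
  show "w \<in> carrier H" using assms by (simp add: spanning_def)
  fix q assume "q \<in> j ` P"
  then obtain p where p: "p \<in> P" "q = j p" by blast
  then obtain a where a: "a \<in> carrier H" "p \<in># \<phi> a" "set_mset (\<phi> a - {#p#}) \<subseteq> set_mset (\<phi> w)"
    using assms by (auto simp: spanning_def)
  have "image_mset j (\<phi> a) - {#q#} = image_mset j (\<phi> a - {#p#})"
    using a p by (simp add: image_mset_Diff)
  then show "\<exists>a\<in>carrier H. q \<in># image_mset j (\<phi> a) \<and> set_mset (image_mset j (\<phi> a) - {#q#}) \<subseteq> set_mset (image_mset j (\<phi> w))"
    using a p by (intro bexI[of _ a]) auto
qed

lemma divisor_theory_cofinal:
  assumes "divisor_theory H P \<phi>"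
  shows "cofinal H (free_monoid P) \<phi>"
proof -
  interpret free_divisor_hom H P \<phi> using assms by (simp add: divisor_theory_iff)
  show ?thesis
    using assms unfolding divisor_theory_iff by (intro cofinal_if_primes_divide) blast
qed

text \<open>A prime is determined by any finite set whose image has it as greatest common divisor.\<close>

lemma divisor_theory_primes_as_lists:
  fixes H :: "('a, 'm) monoid_scheme"
  assumes "divisor_theory H P \<phi>"
  shows "\<exists>j :: 'p \<Rightarrow> 'a list. inj_on j P"
proof -
  have "\<forall>p\<in>P. \<exists>xs. (\<forall>x\<in>set xs. p \<in># \<phi> x) \<and> (\<forall>d. (\<forall>x\<in>set xs. d \<subseteq># \<phi> x) \<longrightarrow> d \<subseteq># {#p#})"
    using assms unfolding divisor_theory_iff by (metis finite_list)
  then obtain j where j: "\<And>p. p \<in> P \<Longrightarrow> (\<forall>x\<in>set (j p). p \<in># \<phi> x) \<and>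
     (\<forall>d. (\<forall>x\<in>set (j p). d \<subseteq># \<phi> x) \<longrightarrow> d \<subseteq># {#p#})" by metis
  have "p = q" if "p \<in> P" "q \<in> P" "j p = j q" for p q
  proof -
    have "\<forall>x\<in>set (j q). {#p#} \<subseteq># \<phi> x" using j[OF that(1)] that(3) by simp
    then have "{#p#} \<subseteq># {#q#}" using j[OF that(2)] by blast
    then show ?thesis by simp
  qed
  then show ?thesis by (intro exI[of _ j]) (auto simp: inj_on_def)
qed

section \<open>Iterating block homomorphisms\<close>

text \<open>
  If \<open>\<psi>\<close> does not shrink \<open>w\<close>, then \<open>\<psi>\<close> is the inclusion by \<open>psi_trivial\<close>. Otherwise take the block
  homomorphism of \<open>\<psi>\<close>; merging primes preserves sizes.
\<close>

lemma shrink_or_divisor_theory: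
  fixes G :: "'u monoid"
  assumes G: "comm_group G" "G0 \<subseteq> carrier G" and span: "spanning (zero_sum_monoid G G0) G0 (\<lambda>S. S) w"
    and inf: "infinite (UNIV :: 'u set)"
  shows "divisor_theory (zero_sum_monoid G G0) G0 (\<lambda>S. S) \<or>
    (\<exists>(G' :: 'u monoid) G0' \<beta>. block_hom (zero_sum_monoid G G0) G' G0' \<beta> \<and> fin_gen_group G' \<and>
      spanning (zero_sum_monoid G' G0') G0' (\<lambda>S. S) (\<beta> w) \<and> size (\<beta> w) < size w)"
proof -
  let ?Z = "zero_sum_monoid G G0"
  interpret Z: free_divisor_hom ?Z G0 "\<lambda>S. S" by (rule zero_sum_free_divisor_hom[OF G])
  interpret B: spanned_submonoid "carrier ?Z" G0 w
    using Z.im.saturated_submonoid_axioms span unfolding image_ident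
    by (intro spanned_submonoid.intro spanned_submonoid_axioms.intro)
     (auto simp: spanning_def carrier_zero_sum_monoid)
  obtain R where R: "R \<subseteq> set_mset w" "B.redundant R" "\<And>h. h \<in> set_mset w - R \<Longrightarrow> \<not> B.redundant (insert h R)"
    using B.maximal_redundant_exists by blast
  interpret B: minimal_primes "carrier ?Z" G0 w R
    using R by unfold_locales
  have fd: "free_divisor_hom ?Z B.Q B.\<psi>"
  proof (intro free_divisor_hom.intro free_divisor_hom_axioms.intro)
    show "comm_monoid_cancel ?Z" by (rule Z.H.is_comm_monoid_cancel)
    fix a b assume ab: "a \<in> carrier ?Z" "b \<in> carrier ?Z"
    show "B.\<psi> (a \<otimes>\<^bsub>?Z\<^esub> b) = B.\<psi> a + B.\<psi> b" using ab B.psi_add by simp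
    assume "B.\<psi> a \<subseteq># B.\<psi> b"
    then show "a divides\<^bsub>?Z\<^esub> b" using ab B.psi_reflects_le Z.reflects_divides by blast
  qed (auto simp: B.psi_empty B.set_psi[THEN subsetD])
  then have dt: "divisor_theory ?Z B.Q B.\<psi>"
    unfolding divisor_theory_iff using B.prime_is_gcd by blast
  \<comment> \<open>The definition of Krull monoids takes lists of elements of the monoid as primes.\<close>
  then have "divisor_theory ?Z ((\<lambda>p. [{#p#}]) ` B.Q) (\<lambda>a. image_mset (\<lambda>p. [{#p#}]) (B.\<psi> a))"
    by (rule rename_divisor_theory) (auto simp: inj_on_def)
  then have krull: "krull_monoid ?Z"
    unfolding krull_monoid_def using Z.H.is_comm_monoid_cancel by blast
  have span': "spanning ?Z B.Q B.\<psi> w"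
    unfolding spanning_def using B.w_mem B.psi_spanning by blast
  show ?thesis
  proof (cases "size (B.\<psi> w) = size w")
    case True
    then have Q: "B.Q = G0" and id: "\<And>M. M \<in> carrier ?Z \<Longrightarrow> B.\<psi> M = M" using B.psi_trivial by blast+
    have "divisor_theory ?Z G0 (\<lambda>S. S)"
      unfolding divisor_theory_iff
    proof (intro conjI ballI)
      fix p assume "p \<in> G0"
      then obtain X where X: "finite X" "X \<noteq> {}" "X \<subseteq> carrier ?Z" "\<forall>x\<in>X. p \<in># B.\<psi> x"
        "\<forall>d. (\<forall>x\<in>X. d \<subseteq># B.\<psi> x) \<longrightarrow> d \<subseteq># {#p#}"
        using B.prime_is_gcd[of p] unfolding Q by blast
      have "B.\<psi> x = x" if "x \<in> X" for x using id X(3) that by blast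
      then show "\<exists>X. finite X \<and> X \<noteq> {} \<and> X \<subseteq> carrier ?Z \<and> (\<forall>x\<in>X. p \<in># x) \<and>
          (\<forall>d. (\<forall>x\<in>X. d \<subseteq># x) \<longrightarrow> d \<subseteq># {#p#})"
        using X by (intro exI[of _ X]) simp
    qed (rule Z.free_divisor_hom_axioms)
    then show ?thesis ..
  next
    case False
    then have "size (B.\<psi> w) < size w" using size_mset_mono[OF B.psi_subset[of w]] by simp
    moreover obtain G' :: "'u monoid" and c where
      "block_hom ?Z G' (c ` B.Q) (\<lambda>a. image_mset c (B.\<psi> a))" "fin_gen_group G'"
      "spanning (zero_sum_monoid G' (c ` B.Q)) (c ` B.Q) (\<lambda>S. S) (image_mset c (B.\<psi> w))"
      using spanning_block_hom_exists[OF krull fd span' inf] by blast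
    ultimately show ?thesis
      by (intro disjI2 exI[of _ G'] exI[of _ "c ` B.Q"] exI[of _ "\<lambda>a. image_mset c (B.\<psi> a)"]) simp
  qed
qed

lemma composition_to_divisor_theory:
  fixes G :: "'u monoid"
  assumes "block_hom_composition H G G0 \<theta>" "fin_gen_group G"
    "spanning (zero_sum_monoid G G0) G0 (\<lambda>S. S) w" and inf: "infinite (UNIV :: 'u set)"
  shows "\<exists>(G' :: 'u monoid) G0' \<theta>'. block_hom_composition H G' G0' \<theta>' \<and> fin_gen_group G' \<and>
    divisor_theory (zero_sum_monoid G' G0') G0' (\<lambda>S. S)"
  using assms(1-3)
proof (induction "size w" arbitrary: G G0 \<theta> w rule: less_induct)
  case less
  have "comm_group G" "G0 \<subseteq> carrier G"
    using block_hom_composition_transfer[OF less.prems(1)] by blast+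
  then consider "divisor_theory (zero_sum_monoid G G0) G0 (\<lambda>S. S)"
    | (shrink) G' :: "'u monoid" and G0' \<beta> where "block_hom (zero_sum_monoid G G0) G' G0' \<beta>" "fin_gen_group G'"
      "spanning (zero_sum_monoid G' G0') G0' (\<lambda>S. S) (\<beta> w)" "size (\<beta> w) < size w"
    using shrink_or_divisor_theory[OF _ _ less.prems(3) inf] by blast
  then show ?case
  proof cases
    case 1
    then show ?thesis using less.prems by blast
  next
    case shrink
    then show ?thesis
      using less.hyps[OF shrink(4) block_hom_composition.comp[OF less.prems(1) shrink(1)] shrink(2,3)] by blast
  qed
qed

theorem theorem3p4:
  fixes H :: "('a, 'm) monoid_scheme"
    and P :: "'p set"
    and \<phi> :: "'a \<Rightarrow> 'p multiset"
  assumes "krull_monoid H"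
    and "divisor_theory H P \<phi>"
    and "fin_gen_group (class_group H P \<phi>)"
  shows "\<exists>(G :: 'a list monoid) G0 \<theta>.
    comm_group G \<and> fin_gen_group G \<and> G0 \<subseteq> carrier G \<and>
    divisor_theory (zero_sum_monoid G G0) G0 (\<lambda>S. S) \<and>
    transfer_hom H (zero_sum_monoid G G0) \<theta> \<and>
    block_hom_composition H G G0 \<theta> \<and>
    length_system H = length_system (zero_sum_monoid G G0) \<and>
    catenary_degree (zero_sum_monoid G G0) \<le> catenary_degree H \<and>
    catenary_degree H \<le> max (catenary_degree (zero_sum_monoid G G0)) 2 \<and>
    (locally_tame H \<longleftrightarrow> locally_tame (zero_sum_monoid G G0))"
proof -
  interpret free_divisor_hom H P \<phi> using assms(2) by (simp add: divisor_theory_iff)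
  obtain w where w: "spanning H P \<phi> w"
    using fin_gen_imp_spanning[OF divisor_theory_cofinal[OF assms(2)] assms(3)] by blast
  obtain j :: "'p \<Rightarrow> 'a list" where j: "inj_on j P"
    using divisor_theory_primes_as_lists[OF assms(2)] by blast
  have inf: "infinite (UNIV :: 'a list set)" by (rule infinite_UNIV_listI)
  obtain G1 :: "'a list monoid" and c where 1:
    "block_hom H G1 (c ` j ` P) (\<lambda>a. image_mset c (image_mset j (\<phi> a)))" "fin_gen_group G1"
    "spanning (zero_sum_monoid G1 (c ` j ` P)) (c ` j ` P) (\<lambda>S. S) (image_mset c (image_mset j (\<phi> w)))"
    using spanning_block_hom_exists[OF assms(1) rename_free_divisor_hom[OF free_divisor_hom_axioms j]
        rename_spanning[OF w] inf] by blast
  obtain G :: "'a list monoid" and G0 \<theta> where comp: "block_hom_composition H G G0 \<theta>"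
    "fin_gen_group G" "divisor_theory (zero_sum_monoid G G0) G0 (\<lambda>S. S)"
    using composition_to_divisor_theory[OF block_hom_composition.single[OF 1(1)] 1(2,3) inf] by blast
  then show ?thesis
    using block_hom_composition_transfer[OF comp(1)] unfolding same_arithmetic_def by blast
qed

end
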